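(* Let $\Lambda$ be a non-empty set and let $A_\lambda:X_\lambda\to Y_\lambda$, $\lambda\in\Lambda$, be a collection of linear operators between Banach spaces with $\sup_{\lambda\in\Lambda}\|A_\lambda\|<\infty$. Then the induced operator $A:(\oplus_{\lambda\in\Lambda}X_\lambda)_{c_0(\Lambda)}\to(\oplus_{\lambda\in\Lambda}Y_\lambda)_{c_0(\Lambda)}$ has summable Szlenk index if and only if the operators $A_\lambda$ have uniformly summable Szlenk index, i.e. there exists $M\geqslant 0$ such that for every $\lambda\in\Lambda$, $A_\lambda$ has $M$-summable Szlenk index.
   Context: The scalar field $\mathbb{K}$ is $\mathbb{R}$ or $\mathbb{C}$. The induced operator $A$ is the operator with $A|_{X_\lambda}=A_\lambda$ for each $\lambda$, i.e. $A((x_\lambda)_{\lambda})=(A_\lambda x_\lambda)_\lambda$. For a Banach space $X$, a weak$^*$-compact $K\subset X^*$ and $\varepsilon>0$, $s_\varepsilon(K)$ denotes the set of those $x^*\in K$ such that $\mathrm{diam}(V\cap K)>\varepsilon$ (norm diameter) for every weak$^*$-neighborhood $V$ of $x^*$; for $\varepsilon\leqslant 0$, $s_\varepsilon(K)=K$. For $M\geqslant 0$, $K$ has $M$-summable Szlenk index if whenever $n\in\mathbb{N}$ and $\varepsilon_1,\ldots,\varepsilon_n\in\mathbb{R}$ are such that $s_{\varepsilon_1}\cdots s_{\varepsilon_n}(K)\neq\varnothing$ (with $s_{\varepsilon_n}$ applied first), then $\sum_{i=1}^n\varepsilon_i\leqslant M$. $K$ has summable Szlenk index if it has $M$-summable Szlenk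 index for some $M\geqslant 0$. An operator $A:X\to Y$ has ($M$-)summable Szlenk index if the weak$^*$-compact set $A^*B_{Y^*}\subset X^*$ does, where $B_{Y^*}$ is the closed unit ball of $Y^*$. *)

theory Defs
  imports "HOL-Analysis.Analysis" "HOL-Algebra.Module"
begin

section \<open>The scalar field\<close>

text \<open>
  A type of this class is, isometrically, \<open>\<real>\<close> (first disjunct) or \<open>\<complex>\<close> (second
  disjunct), so a statement about \<open>'k :: real_or_complex\<close> is a statement about both fields.
\<close>

class real_or_complex = real_normed_field +
  assumes real_or_complex:
    "(\<forall>z. \<exists>a. z = a *\<^sub>R 1) \<or>
     (\<exists>j. j * j = - 1 \<and> (\<forall>z. \<exists>a b. z = a *\<^sub>R 1 + b *\<^sub>R j) \<and>
          (\<forall>a b. norm (a *\<^sub>R 1 + b *\<^sub>R j) = sqrt (a\<^sup>2 + b\<^sup>2)))"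

instance real :: real_or_complex
  by standard auto

instance complex :: real_or_complex
proof
  have "\<forall>z::complex. \<exists>a b. z = a *\<^sub>R 1 + b *\<^sub>R \<i>"
  proof
    fix z :: complex
    have "z = Re z *\<^sub>R 1 + Im z *\<^sub>R \<i>"
      by (simp add: complex_eq_iff)
    then show "\<exists>a b. z = a *\<^sub>R 1 + b *\<^sub>R \<i>"
      by blast
  qed
  moreover have "\<forall>a b. norm (a *\<^sub>R 1 + b *\<^sub>R \<i>) = sqrt (a\<^sup>2 + b\<^sup>2)"
    by (simp add: cmod_def)
  ultimately show "(\<forall>z::complex. \<exists>a. z = a *\<^sub>R 1) \<or>
     (\<exists>j::complex. j * j = - 1 \<and> (\<forall>z. \<exists>a b. z = a *\<^sub>R 1 + b *\<^sub>R j) \<and>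
          (\<forall>a b. norm (a *\<^sub>R 1 + b *\<^sub>R j) = sqrt (a\<^sup>2 + b\<^sup>2)))"
    by (intro disjI2 exI[of _ "\<i>"]) simp
qed


section \<open>Banach spaces\<close>

text \<open>
  Spaces are given by carrier sets, so that the members of a family \<open>X\<^sub>\<lambda>\<close> may be unrelated.
  A vector space is a module in the sense of HOL-Algebra over a field; as for every
  HOL-Algebra module, the \<open>mult\<close> and \<open>one\<close> fields of the record are ignored.
\<close>

record ('k, 'a) nspace = "('k, 'a) module" +
  nrm :: "'a \<Rightarrow> real"

text \<open>The scalars serve both as coefficient ring and as one-dimensional normed space.\<close>

definition scalars :: "('k::real_or_complex, 'k) nspace" where
  "scalars = \<lparr>carrier = UNIV, mult = (*), one = 1, zero = 0, add = (+), smult = (*), nrm = norm\<rparr>"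

locale normed_space = module scalars V
  for V :: "('k::real_or_complex, 'a) nspace" (structure) +
  assumes nrm_eq_zero_iff: "x \<in> carrier V \<Longrightarrow> nrm V x = 0 \<longleftrightarrow> x = \<zero>"
    and nrm_triangle: "\<lbrakk>x \<in> carrier V; y \<in> carrier V\<rbrakk> \<Longrightarrow> nrm V (x \<oplus> y) \<le> nrm V x + nrm V y"
    and nrm_smult: "x \<in> carrier V \<Longrightarrow> nrm V (c \<odot> x) = norm c * nrm V x"

text \<open>The locale \<^locale>\<open>Metric_space\<close> constrains the distance also off the carrier.\<close>

definition ndist :: "('k, 'a) nspace \<Rightarrow> 'a \<Rightarrow> 'a \<Rightarrow> real" where
  "ndist V x y = (if x \<in> carrier V \<and> y \<in> carrier V then nrm V (x \<ominus>\<^bsub>V\<^esub> y) else 0)"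

locale banach_space = normed_space +
  assumes complete: "Metric_space.mcomplete (carrier V) (ndist V)"


section \<open>Operators and duals\<close>

definition linear_ops :: "('k::real_or_complex, 'a) nspace \<Rightarrow> ('k, 'b) nspace \<Rightarrow> ('a \<Rightarrow> 'b) set" where
  "linear_ops V W = {T \<in> carrier V \<rightarrow> carrier W.
     (\<forall>x\<in>carrier V. \<forall>y\<in>carrier V. T (x \<oplus>\<^bsub>V\<^esub> y) = T x \<oplus>\<^bsub>W\<^esub> T y) \<and>
     (\<forall>c. \<forall>x\<in>carrier V. T (c \<odot>\<^bsub>V\<^esub> x) = c \<odot>\<^bsub>W\<^esub> T x)}"

text \<open>Extended-real valued, hence meaningful (namely \<open>\<infinity>\<close>) for unbounded operators as well.\<close>

definition op_norm :: "('k, 'a) nspace \<Rightarrow> ('k, 'b) nspace \<Rightarrow> ('a \<Rightarrow> 'b) \<Rightarrow> ereal" where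
  "op_norm V W T = (SUP x \<in> {x \<in> carrier V. nrm V x \<le> 1}. ereal (nrm W (T x)))"

text \<open>Functionals are extensional, so that equality in the dual is equality on the carrier.\<close>

definition dual :: "('k::real_or_complex, 'a) nspace \<Rightarrow> ('a \<Rightarrow> 'k) set" where
  "dual V = {f \<in> linear_ops V scalars. f \<in> extensional (carrier V) \<and> op_norm V scalars f < \<infinity>}"

definition dual_ball :: "('k::real_or_complex, 'a) nspace \<Rightarrow> ('a \<Rightarrow> 'k) set" where
  "dual_ball V = {f \<in> dual V. op_norm V scalars f \<le> 1}"

text \<open>
  The coarsest topology on the dual making all evaluations \<open>f \<mapsto> f x\<close>, \<open>x \<in> carrier V\<close>, continuous.
\<close>

definition weak_star :: "('k::real_or_complex, 'a) nspace \<Rightarrow> ('a \<Rightarrow> 'k) topology" where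
  "weak_star V = subtopology (product_topology (\<lambda>_. euclidean) (carrier V)) (dual V)"

definition adjoint_op :: "('k, 'a) nspace \<Rightarrow> ('a \<Rightarrow> 'b) \<Rightarrow> ('b \<Rightarrow> 'k) \<Rightarrow> 'a \<Rightarrow> 'k" where
  "adjoint_op V T g = (\<lambda>x\<in>carrier V. g (T x))"


section \<open>Summable Szlenk index\<close>

definition norm_diam :: "('k::real_or_complex, 'a) nspace \<Rightarrow> ('a \<Rightarrow> 'k) set \<Rightarrow> ereal" where
  "norm_diam V S = (SUP (f, g) \<in> S \<times> S. op_norm V scalars (\<lambda>x\<in>carrier V. f x - g x))"

text \<open>
  Quantifying over open \<open>U\<close> covers all weak*-neighbourhoods, as the diameter is monotone.
\<close>

definition szlenk_deriv ::
    "('k::real_or_complex, 'a) nspace \<Rightarrow> real \<Rightarrow> ('a \<Rightarrow> 'k) set \<Rightarrow> ('a \<Rightarrow> 'k) set" where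
  "szlenk_deriv V \<epsilon> K =
     (if \<epsilon> \<le> 0 then K
      else {f \<in> K. \<forall>U. openin (weak_star V) U \<and> f \<in> U \<longrightarrow> norm_diam V (U \<inter> K) > ereal \<epsilon>})"

text \<open>
  The list \<open>[\<epsilon>\<^sub>1, \<dots>, \<epsilon>\<^sub>n]\<close> stands for the finite sequence; \<^const>\<open>foldr\<close> applies the derivation
  for its last entry first.
\<close>

definition set_summable_szlenk ::
    "('k::real_or_complex, 'a) nspace \<Rightarrow> real \<Rightarrow> ('a \<Rightarrow> 'k) set \<Rightarrow> bool" where
  "set_summable_szlenk V M K \<longleftrightarrow>
     (\<forall>\<epsilon>s. foldr (szlenk_deriv V) \<epsilon>s K \<noteq> {} \<longrightarrow> sum_list \<epsilon>s \<le> M)"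

definition M_summable_szlenk ::
    "real \<Rightarrow> ('k::real_or_complex, 'a) nspace \<Rightarrow> ('k, 'b) nspace \<Rightarrow> ('a \<Rightarrow> 'b) \<Rightarrow> bool" where
  "M_summable_szlenk M V W T \<longleftrightarrow> set_summable_szlenk V M (adjoint_op V T ` dual_ball W)"

definition summable_szlenk ::
    "('k::real_or_complex, 'a) nspace \<Rightarrow> ('k, 'b) nspace \<Rightarrow> ('a \<Rightarrow> 'b) \<Rightarrow> bool" where
  "summable_szlenk V W T \<longleftrightarrow> (\<exists>M\<ge>0. M_summable_szlenk M V W T)"


section \<open>Direct sums\<close>

definition c0_sum ::
    "'i set \<Rightarrow> ('i \<Rightarrow> ('k::real_or_complex, 'a) nspace) \<Rightarrow> ('k, 'i \<Rightarrow> 'a) nspace" where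
  "c0_sum \<Lambda> X = \<lparr>
     carrier = {x \<in> (\<Pi>\<^sub>E i\<in>\<Lambda>. carrier (X i)).
                  \<forall>\<epsilon>>0. finite {i\<in>\<Lambda>. nrm (X i) (x i) \<ge> \<epsilon>}},
     mult = undefined, one = undefined,
     zero = (\<lambda>i\<in>\<Lambda>. \<zero>\<^bsub>X i\<^esub>),
     add = (\<lambda>x y. \<lambda>i\<in>\<Lambda>. x i \<oplus>\<^bsub>X i\<^esub> y i),
     smult = (\<lambda>c x. \<lambda>i\<in>\<Lambda>. c \<odot>\<^bsub>X i\<^esub> x i),
     nrm = (\<lambda>x. SUP i\<in>\<Lambda>. nrm (X i) (x i))\<rparr>"

definition induced_op :: "'i set \<Rightarrow> ('i \<Rightarrow> 'a \<Rightarrow> 'b) \<Rightarrow> ('i \<Rightarrow> 'a) \<Rightarrow> 'i \<Rightarrow> 'b" where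
  "induced_op \<Lambda> A x = (\<lambda>i\<in>\<Lambda>. A i (x i))"

end

theory Submission
  imports Defs
begin

text \<open>
  Let \<open>R\<close> bound all \<open>\<parallel>A\<^sub>\<lambda>\<parallel>\<close>, and let \<open>K\<^sub>\<lambda>(c)\<close> be the image of the ball of radius \<open>c\<close> under
  \<open>A\<^sub>\<lambda>\<^sup>*\<close>. The adjoint of the projection onto \<open>X\<^sub>\<lambda>\<close> is a weak*-continuous isometry carrying the Szlenk
  derivations of \<open>K\<^sub>\<lambda>(1)\<close> into those of the corresponding set \<open>K\<close> for the direct sum; this gives one
  direction, with the same \<open>M\<close>.

  For the other one, let \<open>T\<^sub>\<eta>(S)\<close> be the set of all \<open>f\<close> such that every weak*-neighbourhood of \<open>f\<close>
  contains some \<open>g \<in> S\<close> with \<open>\<parallel>g - f\<parallel> \<ge> \<eta>\<close>, and define the potential \<open>\<psi>\<^sub>k(f)\<close> of \<open>f \<in> K\<^sub>\<lambda>(1)\<close> as the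
  infimum of \<open>(M + R) c - (\<eta>\<^sub>1 + \<dots> + \<eta>\<^sub>k)\<close> over all \<open>c\<close> and \<open>\<eta>\<^sub>i \<ge> 0\<close> with
  \<open>f \<in> T\<^bsub>\<eta>\<^sub>1\<^esub> \<dots> T\<^bsub>\<eta>\<^sub>k\<^esub> (K\<^sub>\<lambda>(c))\<close>. As \<open>K\<^sub>\<lambda>(c)\<close> is weak*-closed and \<open>c M\<close>-summable, \<open>\<psi>\<^sub>k(f) \<ge> R c \<ge> \<parallel>f\<parallel>\<close>.
  A pigeonhole argument shows \<open>\<psi>\<^bsub>k+1\<^esub>(f) + \<parallel>g - f\<parallel> \<le> \<psi>\<^sub>k(g) + \<delta>\<close> for all \<open>g\<close> near \<open>f\<close>. Hence the sum
  of the potentials of the coordinates drops by at least \<open>\<epsilon> / 2\<close> with each derivation \<open>s\<^sub>\<epsilon>\<close> of \<open>K\<close>: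
  near \<open>f\<close>, the coordinates carrying almost all of \<open>\<parallel>f\<parallel>\<close> obey the step inequality, and on the
  others \<open>\<psi>\<^sub>k(g\<^sub>\<lambda>) \<ge> \<parallel>g\<^sub>\<lambda>\<parallel>\<close> absorbs the difference. It starts below \<open>M + R\<close> and stays nonnegative, so
  \<open>K\<close> is \<open>2 (M + R)\<close>-summable.
\<close>

section \<open>Bounded functionals\<close>

text \<open>In the two-dimensional case the ball is a closed subset of the continuous image of a
  square. This compactness feeds Tychonoff's theorem in
  \<open>compactin_weak_star_ball\<close>.\<close>

lemma compact_cball_scalar: "compact (cball (0::'k::real_or_complex) r)"
proof -
  consider (r) "\<forall>z::'k. \<exists>a. z = a *\<^sub>R 1"
    | (c) j where "\<forall>z::'k. \<exists>a b. z = a *\<^sub>R 1 + b *\<^sub>R j"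
        "\<forall>a b. norm (a *\<^sub>R 1 + b *\<^sub>R j :: 'k) = sqrt (a\<^sup>2 + b\<^sup>2)"
    using real_or_complex by blast
  then show ?thesis
  proof cases
    case r
    have "cball (0::'k) r = (\<lambda>a. a *\<^sub>R 1) ` cball 0 r"
      using r by (fastforce simp: image_iff)
    moreover have "compact ((\<lambda>a. a *\<^sub>R (1::'k)) ` cball 0 r)"
      by (intro compact_continuous_image continuous_intros compact_cball)
    ultimately show ?thesis by simp
  next
    case (c j)
    let ?h = "\<lambda>p::real \<times> real. fst p *\<^sub>R 1 + snd p *\<^sub>R j"
    have "compact (?h ` (cball 0 r \<times> cball 0 r))"
      by (intro compact_continuous_image continuous_intros compact_Times compact_cball)
    moreover have "cball (0::'k) r \<subseteq> ?h ` (cball 0 r \<times> cball 0 r)"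
    proof
      fix z :: 'k assume z: "z \<in> cball 0 r"
      obtain a b where ab: "z = a *\<^sub>R 1 + b *\<^sub>R j" using c(1) by blast
      then have "sqrt (a\<^sup>2 + b\<^sup>2) \<le> r" using z c(2) by simp
      then have "\<bar>a\<bar> \<le> r" "\<bar>b\<bar> \<le> r"
        using real_sqrt_ge_abs1[of a b] real_sqrt_ge_abs2[of b a] by linarith+
      then show "z \<in> ?h ` (cball 0 r \<times> cball 0 r)"
        using ab by (auto intro!: image_eqI[of _ _ "(a, b)"])
    qed
    ultimately show ?thesis
      using compact_Int_closed[OF _ closed_cball, of "?h ` (cball 0 r \<times> cball 0 r)" "0::'k" r]
      by (simp only: inf.absorb2)
  qed
qed

lemma scalars_simps [simp]:
  "carrier scalars = UNIV" "x \<otimes>\<^bsub>scalars\<^esub> y = x * y" "\<one>\<^bsub>scalars\<^esub> = 1"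
  "\<zero>\<^bsub>scalars\<^esub> = 0" "x \<oplus>\<^bsub>scalars\<^esub> y = x + y" "c \<odot>\<^bsub>scalars\<^esub> y = c * y" "nrm scalars x = norm x"
  by (simp_all add: scalars_def)

lemma linear_opsD:
  assumes "T \<in> linear_ops V W"
  shows "x \<in> carrier V \<Longrightarrow> T x \<in> carrier W"
    "x \<in> carrier V \<Longrightarrow> y \<in> carrier V \<Longrightarrow> T (x \<oplus>\<^bsub>V\<^esub> y) = T x \<oplus>\<^bsub>W\<^esub> T y"
    "x \<in> carrier V \<Longrightarrow> T (c \<odot>\<^bsub>V\<^esub> x) = c \<odot>\<^bsub>W\<^esub> T x"
  using assms unfolding linear_ops_def by auto

lemma dualD:
  assumes "f \<in> dual V"
  shows "f \<in> linear_ops V scalars" "f \<in> extensional (carrier V)"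
    "x \<in> carrier V \<Longrightarrow> y \<in> carrier V \<Longrightarrow> f (x \<oplus>\<^bsub>V\<^esub> y) = f x + f y"
    "x \<in> carrier V \<Longrightarrow> f (c \<odot>\<^bsub>V\<^esub> x) = c * f x"
  using assms unfolding dual_def linear_ops_def by auto

text \<open>Meaningful for functionals bounded on the unit ball only.\<close>

definition dual_norm :: "('k::real_or_complex, 'a) nspace \<Rightarrow> ('a \<Rightarrow> 'k) \<Rightarrow> real" where
  "dual_norm V f = real_of_ereal (op_norm V scalars f)"

definition dual_dist :: "('k::real_or_complex, 'a) nspace \<Rightarrow> ('a \<Rightarrow> 'k) \<Rightarrow> ('a \<Rightarrow> 'k) \<Rightarrow> real" where
  "dual_dist V f g = dual_norm V (\<lambda>x\<in>carrier V. f x - g x)"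

section \<open>Norm estimates for operators and functionals\<close>

context normed_space
begin

lemma zero_smult: "x \<in> carrier V \<Longrightarrow> 0 \<odot>\<^bsub>V\<^esub> x = \<zero>\<^bsub>V\<^esub>"
  using smult_l_null[of x] by simp

lemma smult_scalars_closed [simp, intro]: "x \<in> carrier V \<Longrightarrow> c \<odot>\<^bsub>V\<^esub> x \<in> carrier V"
  by simp

lemma nrm_zero [simp]: "nrm V \<zero>\<^bsub>V\<^esub> = 0"
  using nrm_eq_zero_iff by simp

text \<open>Nonnegativity comes from the triangle inequality: 0 = ||x + (-1) x|| \<le> 2
  ||x||.\<close>

lemma nrm_nonneg: 
  assumes x: "x \<in> carrier V" shows "0 \<le> nrm V x"
proof -
  have "x \<oplus>\<^bsub>V\<^esub> (- 1) \<odot>\<^bsub>V\<^esub> x = (1 + - 1) \<odot>\<^bsub>V\<^esub> x"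
    using smult_l_distr[of 1 "- 1" x] smult_one[OF x] x by simp
  then have "x \<oplus>\<^bsub>V\<^esub> (- 1) \<odot>\<^bsub>V\<^esub> x = \<zero>\<^bsub>V\<^esub>"
    using zero_smult x by simp
  then have "0 \<le> nrm V x + nrm V ((- 1) \<odot>\<^bsub>V\<^esub> x)"
    using nrm_triangle[of x "(- 1) \<odot>\<^bsub>V\<^esub> x"] x by simp
  then show ?thesis using nrm_smult[OF x, of "- 1"] by simp
qed

lemma op_norm_nonneg:
  assumes "T \<in> linear_ops V W" "normed_space W"
  shows "0 \<le> op_norm V W T"
proof -
  have "ereal (nrm W (T \<zero>\<^bsub>V\<^esub>)) \<le> op_norm V W T"
    unfolding op_norm_def by (rule SUP_upper) simp
  moreover have "0 \<le> nrm W (T \<zero>\<^bsub>V\<^esub>)"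
    using normed_space.nrm_nonneg[OF assms(2)] linear_opsD(1)[OF assms(1)] by simp
  ultimately show ?thesis by (metis ereal_less_eq(5) order_trans)
qed

lemma op_norm_bound:
  assumes T: "T \<in> linear_ops V W" and W: "normed_space W" and le: "op_norm V W T \<le> ereal r"
    and x: "x \<in> carrier V"
  shows "nrm W (T x) \<le> r * nrm V x"
proof -
  have ball: "nrm W (T y) \<le> r" if "y \<in> carrier V" "nrm V y \<le> 1" for y
  proof -
    have "ereal (nrm W (T y)) \<le> op_norm V W T"
      unfolding op_norm_def by (rule SUP_upper) (use that in simp)
    then show ?thesis using le by (metis ereal_less_eq(3) order_trans)
  qed
  have scale: "\<bar>t\<bar> * nrm W (T x) \<le> r" if "\<bar>t\<bar> * nrm V x \<le> 1" for t :: real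
    using ball[of "of_real t \<odot>\<^bsub>V\<^esub> x"] that x nrm_smult[OF x, of "of_real t"]
      normed_space.nrm_smult[OF W linear_opsD(1)[OF T x], of "of_real t"] linear_opsD(3)[OF T x]
    by simp
  show ?thesis
  proof (cases "nrm V x = 0")
    case False
    then have "0 < nrm V x" using nrm_nonneg[OF x] by simp
    then show ?thesis using scale[of "1 / nrm V x"] by (simp add: field_simps)
  next
    \<comment> \<open>Division by the norm is impossible here; definiteness gives x = 0 = 0 x, hence
      T x = 0 T x.\<close>
    case True
    then have "x = \<zero>\<^bsub>V\<^esub>" using nrm_eq_zero_iff x by simp
    then have "T x = T (0 \<odot>\<^bsub>V\<^esub> x)" using zero_smult[OF x] by simp
    then have "T x = 0 \<odot>\<^bsub>W\<^esub> T x" using linear_opsD(3)[OF T x] by simp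
    then have "nrm W (T x) = 0"
      using normed_space.nrm_smult[OF W linear_opsD(1)[OF T x], of 0] by simp
    then show ?thesis using True by simp
  qed
qed

lemma op_norm_le:
  assumes "\<And>x. x \<in> carrier V \<Longrightarrow> nrm W (T x) \<le> r * nrm V x" "0 \<le> r"
  shows "op_norm V W T \<le> ereal r"
  unfolding op_norm_def
proof (rule SUP_least)
  fix x assume x: "x \<in> {x \<in> carrier V. nrm V x \<le> 1}"
  then have "nrm W (T x) \<le> r * nrm V x" using assms by simp
  also have "\<dots> \<le> r" using x assms(2) by (simp add: mult_left_le)
  finally show "ereal (nrm W (T x)) \<le> ereal r" by simp
qed

text \<open>Placed inside the locale because the ring property \<open>is_cring\<close> of
  \<open>scalars\<close> is inherited from \<open>module scalars V\<close>.\<close>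

lemma normed_space_scalars: "normed_space (scalars :: ('k, 'k) nspace)"
proof (rule normed_space.intro)
  have "abelian_group (scalars :: ('k, 'k) nspace)"
  proof (rule abelian_groupI)
    fix x :: 'k
    show "\<exists>y\<in>carrier scalars. y \<oplus>\<^bsub>scalars\<^esub> x = \<zero>\<^bsub>scalars\<^esub>"
      by (rule bexI[of _ "- x"]) auto
  qed (simp_all add: algebra_simps)
  then show "module scalars (scalars :: ('k, 'k) nspace)"
    by (intro moduleI is_cring) (simp_all add: algebra_simps)
qed (unfold_locales, simp_all add: norm_mult norm_triangle_ineq)

lemma op_norm_dual:
  assumes f: "f \<in> dual V"
  shows "op_norm V scalars f = ereal (dual_norm V f)"
  using f op_norm_nonneg[OF dualD(1)[OF f] normed_space_scalars]
  by (auto simp: dual_def dual_norm_def ereal_real)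

lemma dual_norm_nonneg: "f \<in> dual V \<Longrightarrow> 0 \<le> dual_norm V f"
  using op_norm_nonneg[OF dualD(1) normed_space_scalars] op_norm_dual by fastforce

lemma norm_le_dual_norm: "f \<in> dual V \<Longrightarrow> x \<in> carrier V \<Longrightarrow> norm (f x) \<le> dual_norm V f * nrm V x"
  using op_norm_bound[OF dualD(1) normed_space_scalars] op_norm_dual by fastforce

lemma dualI:
  assumes "f \<in> extensional (carrier V)"
    and "\<And>x y. x \<in> carrier V \<Longrightarrow> y \<in> carrier V \<Longrightarrow> f (x \<oplus>\<^bsub>V\<^esub> y) = f x + f y"
    and "\<And>c x. x \<in> carrier V \<Longrightarrow> f (c \<odot>\<^bsub>V\<^esub> x) = c * f x"
    and le: "\<And>x. x \<in> carrier V \<Longrightarrow> norm (f x) \<le> r * nrm V x" and r: "0 \<le> r"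
  shows "f \<in> dual V" "dual_norm V f \<le> r"
proof -
  have "op_norm V scalars f \<le> ereal r"
    using op_norm_le[of scalars f r] le r by simp
  moreover from this have "op_norm V scalars f < \<infinity>"
    using le_less_trans[of _ "ereal r" \<infinity>] by simp
  ultimately show f: "f \<in> dual V" 
    using assms(1-3) unfolding dual_def linear_ops_def by auto
  show "dual_norm V f \<le> r"
    using \<open>op_norm V scalars f \<le> ereal r\<close> op_norm_dual[OF f] by simp
qed

lemma dual_diff:
  assumes f: "f \<in> dual V" and g: "g \<in> dual V"
  shows "(\<lambda>x\<in>carrier V. f x - g x) \<in> dual V" "dual_dist V f g \<le> dual_norm V f + dual_norm V g"
proof -
  have le: "norm (f x - g x) \<le> (dual_norm V f + dual_norm V g) * nrm V x" if "x \<in> carrier V" for x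
    using norm_le_dual_norm[OF f that] norm_le_dual_norm[OF g that] norm_triangle_ineq4[of "f x" "g x"]
    by (simp add: algebra_simps)
  note * = dualI[of "\<lambda>x\<in>carrier V. f x - g x" "dual_norm V f + dual_norm V g"]
  show "(\<lambda>x\<in>carrier V. f x - g x) \<in> dual V" "dual_dist V f g \<le> dual_norm V f + dual_norm V g"
    unfolding dual_dist_def
    using le dual_norm_nonneg[OF f] dual_norm_nonneg[OF g] 
    by (auto intro!: * simp: dualD[OF f] dualD[OF g] algebra_simps)
qed

lemma norm_diff_le_dual_dist:
  assumes "f \<in> dual V" "g \<in> dual V" "x \<in> carrier V"
  shows "norm (f x - g x) \<le> dual_dist V f g * nrm V x"
  using norm_le_dual_norm[OF dual_diff(1)[OF assms(1,2)] assms(3)] assms(3)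
  by (simp add: dual_dist_def)

lemma dual_dist_le:
  assumes "f \<in> dual V" "g \<in> dual V" "0 \<le> r"
    and "\<And>x. x \<in> carrier V \<Longrightarrow> norm (f x - g x) \<le> r * nrm V x"
  shows "dual_dist V f g \<le> r"
  unfolding dual_dist_def
  by (rule dualI(2)) (use assms dualD(3,4)[OF dual_diff(1)[OF assms(1,2)]] in auto)

lemma dual_dist_nonneg: "f \<in> dual V \<Longrightarrow> g \<in> dual V \<Longrightarrow> 0 \<le> dual_dist V f g"
  unfolding dual_dist_def by (rule dual_norm_nonneg[OF dual_diff(1)])

lemma dual_dist_self: "f \<in> dual V \<Longrightarrow> dual_dist V f f = 0"
  by (intro antisym dual_dist_le dual_dist_nonneg) auto

lemma dual_dist_commute:
  assumes "f \<in> dual V" "g \<in> dual V"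
  shows "dual_dist V f g = dual_dist V g f"
  using assms norm_diff_le_dual_dist[of f g] norm_diff_le_dual_dist[of g f]
  by (intro antisym dual_dist_le dual_dist_nonneg) (auto simp: norm_minus_commute)

lemma dual_dist_triangle:
  assumes f: "f \<in> dual V" and g: "g \<in> dual V" and h: "h \<in> dual V"
  shows "dual_dist V f h \<le> dual_dist V f g + dual_dist V g h"
proof (rule dual_dist_le[OF f h])
  fix x assume x: "x \<in> carrier V"
  have "norm (f x - h x) \<le> norm (f x - g x) + norm (g x - h x)"
    using norm_triangle_ineq[of "f x - g x" "g x - h x"] by simp
  then show "norm (f x - h x) \<le> (dual_dist V f g + dual_dist V g h) * nrm V x"
    using norm_diff_le_dual_dist[OF f g x] norm_diff_le_dual_dist[OF g h x]
    by (simp add: algebra_simps)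
qed (simp add: dual_dist_nonneg f g h)

lemma less_norm_diam_iff:
  assumes "S \<subseteq> dual V"
  shows "ereal \<epsilon> < norm_diam V S \<longleftrightarrow> (\<exists>f\<in>S. \<exists>g\<in>S. \<epsilon> < dual_dist V f g)"
proof -
  have "op_norm V scalars (\<lambda>x\<in>carrier V. f x - g x) = ereal (dual_dist V f g)"
    if "f \<in> S" "g \<in> S" for f g
    unfolding dual_dist_def using that assms by (intro op_norm_dual dual_diff(1)) auto
  then show ?thesis
    unfolding norm_diam_def by (auto simp: less_SUP_iff)
qed

lemma mem_szlenk_deriv_iff:
  assumes "S \<subseteq> dual V" "0 < \<epsilon>"
  shows "f \<in> szlenk_deriv V \<epsilon> S \<longleftrightarrow>
    f \<in> S \<and> (\<forall>U. openin (weak_star V) U \<and> f \<in> U \<longrightarrow> (\<exists>g\<in>U \<inter> S. \<exists>h\<in>U \<inter> S. \<epsilon> < dual_dist V g h))"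
proof -
  have "U \<inter> S \<subseteq> dual V" for U using assms by auto
  from less_norm_diam_iff[OF this] show ?thesis 
    unfolding szlenk_deriv_def using assms(2) by auto
qed

end

lemma szlenk_deriv_subset: "szlenk_deriv V \<epsilon> S \<subseteq> S"
  by (auto simp: szlenk_deriv_def)

lemma foldr_szlenk_deriv_subset: "foldr (szlenk_deriv V) \<epsilon>s S \<subseteq> S"
  by (induction \<epsilon>s) (use szlenk_deriv_subset in fastforce)+

lemma szlenk_deriv_mono:
  assumes "S \<subseteq> T"
  shows "szlenk_deriv V \<epsilon> S \<subseteq> szlenk_deriv V \<epsilon> T"
proof -
  have "norm_diam V (U \<inter> S) \<le> norm_diam V (U \<inter> T)" for U
    unfolding norm_diam_def by (rule SUP_subset_mono) (use assms in auto)
  then show ?thesis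
    using assms by (auto simp: szlenk_deriv_def intro: less_le_trans)
qed

section \<open>The weak* topology\<close>

context normed_space
begin

lemma dual_subset_PiE: "dual V \<subseteq> (\<Pi>\<^sub>E x\<in>carrier V. UNIV)"
  by (auto simp: dual_def PiE_def)

lemma topspace_weak_star [simp]: "topspace (weak_star V) = dual V"
  using dual_subset_PiE by (auto simp: weak_star_def)

lemma continuous_map_weak_star_eval:
  "x \<in> carrier V \<Longrightarrow> continuous_map (weak_star V) euclidean (\<lambda>f. f x)"
  unfolding weak_star_def
  by (rule continuous_map_from_subtopology) (rule continuous_map_product_projection[of _ _ "\<lambda>_. euclidean"])

lemma continuous_map_into_weak_star:
  assumes "\<Phi> \<in> topspace X \<rightarrow> dual V"
    and "\<And>x. x \<in> carrier V \<Longrightarrow> continuous_map X euclidean (\<lambda>f. \<Phi> f x)"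
  shows "continuous_map X (weak_star V) \<Phi>"
  using assms dual_subset_PiE unfolding weak_star_def
  by (intro continuous_map_into_subtopology) (auto simp: continuous_map_componentwise PiE_def)

lemma Hausdorff_space_weak_star: "Hausdorff_space (weak_star V)"
  unfolding weak_star_def
  by (intro Hausdorff_space_subtopology) (simp add: Hausdorff_space_product_topology)

text \<open>Banach-Alaoglu: inside the Tychonoff product of the discs of radius
  \<open>r * nrm V x\<close>, the ball is cut out by closed conditions, one for each instance of
  additivity (\<open>add\<close>) and of homogeneity (\<open>hom\<close>).\<close>

lemma compactin_weak_star_ball:
  assumes r: "0 \<le> r"
  shows "compactin (weak_star V) {f \<in> dual V. dual_norm V f \<le> r}"
proof -
  define P where "P = product_topology (\<lambda>_. euclidean :: 'k topology) (carrier V)"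
  have top: "topspace P = (\<Pi>\<^sub>E x\<in>carrier V. UNIV)" by (simp add: P_def)
  have eval: "continuous_map P euclidean (\<lambda>f. f x)" if "x \<in> carrier V" for x
    using continuous_map_product_projection[OF that, of "\<lambda>_. euclidean"] by (simp add: P_def)
  define add where "add = (\<lambda>(x, y). {f \<in> topspace P. f (x \<oplus>\<^bsub>V\<^esub> y) = f x + f y})"
  define hom where "hom = (\<lambda>(c, x). {f \<in> topspace P. f (c \<odot>\<^bsub>V\<^esub> x) = c * f x})"
  have "closedin P (add p)" if "p \<in> carrier V \<times> carrier V" for p
    using that by (auto simp: add_def intro!: closedin_continuous_maps_eq[of euclidean] eval continuous_map_add)
  moreover have "closedin P (hom p)" if "p \<in> UNIV \<times> carrier V" for p
  proof -
    have "continuous_map P euclidean (\<lambda>f. c * f x)" if "x \<in> carrier V" for c x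
      using continuous_map_compose[OF eval[OF that], of euclidean "\<lambda>z. c * z"]
      by (simp add: o_def continuous_on_mult_left)
    then show ?thesis
      using that by (auto simp: hom_def intro!: closedin_continuous_maps_eq[of euclidean] eval)
  qed
  moreover have "compactin P (\<Pi>\<^sub>E x\<in>carrier V. cball 0 (r * nrm V x))"
    by (simp add: P_def compactin_PiE compact_cball_scalar)
  ultimately have "compactin P (\<Inter> ({\<Pi>\<^sub>E x\<in>carrier V. cball 0 (r * nrm V x)} \<union>
      add ` (carrier V \<times> carrier V) \<union> hom ` (UNIV \<times> carrier V)))"
    by (intro closed_compactin_Inter[of P "\<Pi>\<^sub>E x\<in>carrier V. cball 0 (r * nrm V x)"])
      (auto intro: compactin_imp_closedin simp: P_def Hausdorff_space_product_topology)
  moreover have "\<Inter> ({\<Pi>\<^sub>E x\<in>carrier V. cball 0 (r * nrm V x)} \<union>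
      add ` (carrier V \<times> carrier V) \<union> hom ` (UNIV \<times> carrier V)) =
    {f \<in> dual V. dual_norm V f \<le> r}" (is "?L = ?R")
  proof
    show "?L \<subseteq> ?R"
    proof
      fix f assume f: "f \<in> ?L"
      have PiE: "f \<in> (\<Pi>\<^sub>E x\<in>carrier V. cball 0 (r * nrm V x))"
        and add: "\<And>p. p \<in> carrier V \<times> carrier V \<Longrightarrow> f \<in> add p"
        and hom: "\<And>p. p \<in> UNIV \<times> carrier V \<Longrightarrow> f \<in> hom p"
        by (rule InterD[OF f], blast)+
      have "f \<in> extensional (carrier V)"
        using PiE by (simp add: PiE_def)
      moreover have "f (x \<oplus>\<^bsub>V\<^esub> y) = f x + f y" if "x \<in> carrier V" "y \<in> carrier V" for x y
        using add[of "(x, y)"] that by (simp add: add_def)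
      moreover have "f (c \<odot>\<^bsub>V\<^esub> x) = c * f x" if "x \<in> carrier V" for c x
        using hom[of "(c, x)"] that by (simp add: hom_def)
      moreover have "norm (f x) \<le> r * nrm V x" if "x \<in> carrier V" for x
        using PiE_mem[OF PiE that] by simp
      ultimately show "f \<in> ?R" using dualI[of f r] r by simp
    qed
    show "?R \<subseteq> ?L"
    proof
      fix f assume f: "f \<in> ?R"
      then have fV: "f \<in> dual V" by simp
      have "norm (f x) \<le> r * nrm V x" if "x \<in> carrier V" for x
      proof -
        have "dual_norm V f * nrm V x \<le> r * nrm V x"
          using f nrm_nonneg[OF that] by (intro mult_right_mono) auto
        then show ?thesis using norm_le_dual_norm[OF fV that] by simp
      qed
      then have "f \<in> (\<Pi>\<^sub>E x\<in>carrier V. cball 0 (r * nrm V x))" "f \<in> topspace P"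
        using dualD(2)[OF fV] by (auto simp: PiE_def top)
      moreover have "f \<in> add p" if "p \<in> carrier V \<times> carrier V" for p
        using that \<open>f \<in> topspace P\<close> dualD(3)[OF fV] by (auto simp: add_def)
      moreover have "f \<in> hom p" if "p \<in> UNIV \<times> carrier V" for p
        using that \<open>f \<in> topspace P\<close> dualD(4)[OF fV] by (auto simp: hom_def)
      ultimately show "f \<in> ?L"
        by (intro InterI) (elim UnE imageE; simp)
    qed
  qed
  ultimately have "compactin P {f \<in> dual V. dual_norm V f \<le> r}" by simp
  then show ?thesis
    unfolding weak_star_def P_def[symmetric] by (rule compact_imp_compactin_subtopology) blast
qed

end

section \<open>Transport of Szlenk derivations\<close>

text \<open>A neighbourhood of the image point pulls back to a neighbourhood of \<open>f\<close>,
  which contains two points of \<open>S\<close> more than \<epsilon> apart; their images are more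
  than t \<epsilon> apart.\<close>

lemma szlenk_deriv_image:
  assumes V: "normed_space V" and W: "normed_space W"
    and cont: "continuous_map (weak_star V) (weak_star W) \<Phi>"
    and S: "S \<subseteq> dual V" and t: "0 < t"
    and dist: "\<And>f g. f \<in> S \<Longrightarrow> g \<in> S \<Longrightarrow> t * dual_dist V f g \<le> dual_dist W (\<Phi> f) (\<Phi> g)"
  shows "\<Phi> ` szlenk_deriv V \<epsilon> S \<subseteq> szlenk_deriv W (t * \<epsilon>) (\<Phi> ` S)"
proof (cases "0 < \<epsilon>")
  case False
  \<comment> \<open>For \<epsilon> \<le> 0 both derivations are the identity by convention.\<close>
  then have "t * \<epsilon> \<le> 0" using t by (simp add: mult_le_0_iff)
  then show ?thesis using False by (simp add: szlenk_deriv_def)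
next
  case True
  have \<Phi>S: "\<Phi> ` S \<subseteq> dual W"
    using cont S normed_space.topspace_weak_star[OF V] normed_space.topspace_weak_star[OF W]
    by (fastforce simp: continuous_map_def)
  show ?thesis
  proof
    fix f' assume "f' \<in> \<Phi> ` szlenk_deriv V \<epsilon> S"
    then obtain f where f: "f' = \<Phi> f" "f \<in> S"
      and sep: "\<And>U. openin (weak_star V) U \<Longrightarrow> f \<in> U \<Longrightarrow> \<exists>g\<in>U \<inter> S. \<exists>h\<in>U \<inter> S. \<epsilon> < dual_dist V g h"
      using normed_space.mem_szlenk_deriv_iff[OF V S True] by auto
    have "\<exists>g\<in>U \<inter> \<Phi> ` S. \<exists>h\<in>U \<inter> \<Phi> ` S. t * \<epsilon> < dual_dist W g h"
      if U: "openin (weak_star W) U" "f' \<in> U" for U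
    proof -
      have "openin (weak_star V) {g \<in> topspace (weak_star V). \<Phi> g \<in> U}"
        by (rule openin_continuous_map_preimage[OF cont U(1)])
      then obtain g h where gh: "g \<in> S" "h \<in> S" "\<Phi> g \<in> U" "\<Phi> h \<in> U" "\<epsilon> < dual_dist V g h"
        using sep[of "{g \<in> topspace (weak_star V). \<Phi> g \<in> U}"] U(2) f S
          normed_space.topspace_weak_star[OF V] by auto
      then have "t * \<epsilon> < dual_dist W (\<Phi> g) (\<Phi> h)"
        using dist[OF gh(1,2)] t mult_strict_left_mono[OF gh(5) t] by linarith
      then show ?thesis using gh by blast
    qed
    moreover have "0 < t * \<epsilon>" using t True by simp
    ultimately show "f' \<in> szlenk_deriv W (t * \<epsilon>) (\<Phi> ` S)"
      using normed_space.mem_szlenk_deriv_iff[OF W \<Phi>S, of "t * \<epsilon>" f'] f by blast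
  qed
qed

text \<open>Applied to the adjoint of a coordinate projection with \<open>t = 1\<close>, and to
  multiplication by \<open>1 / c\<close> with \<open>t = 1 / c\<close>.\<close>

lemma foldr_szlenk_deriv_image:
  assumes V: "normed_space V" and W: "normed_space W"
    and cont: "continuous_map (weak_star V) (weak_star W) \<Phi>"
    and S: "S \<subseteq> dual V" and t: "0 < t"
    and dist: "\<And>f g. f \<in> S \<Longrightarrow> g \<in> S \<Longrightarrow> t * dual_dist V f g \<le> dual_dist W (\<Phi> f) (\<Phi> g)"
  shows "\<Phi> ` foldr (szlenk_deriv V) \<epsilon>s S \<subseteq> foldr (szlenk_deriv W) (map ((*) t) \<epsilon>s) (\<Phi> ` S)"
proof (induction \<epsilon>s)
  case (Cons \<epsilon> \<epsilon>s)
  let ?D = "foldr (szlenk_deriv V) \<epsilon>s S"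
  have sub: "?D \<subseteq> S" by (rule foldr_szlenk_deriv_subset)
  have "\<Phi> ` szlenk_deriv V \<epsilon> ?D \<subseteq> szlenk_deriv W (t * \<epsilon>) (\<Phi> ` ?D)"
    using sub by (intro szlenk_deriv_image[OF V W cont _ t] dist order_trans[OF sub S]) auto
  also have "\<dots> \<subseteq> szlenk_deriv W (t * \<epsilon>) (foldr (szlenk_deriv W) (map ((*) t) \<epsilon>s) (\<Phi> ` S))"
    by (rule szlenk_deriv_mono[OF Cons.IH])
  finally show ?case by simp
qed simp

lemma foldr_szlenk_deriv_mono:
  "S \<subseteq> S' \<Longrightarrow> foldr (szlenk_deriv V) \<epsilon>s S \<subseteq> foldr (szlenk_deriv V) \<epsilon>s S'"
proof (induction \<epsilon>s)
  case (Cons \<epsilon> \<epsilon>s)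
  then show ?case using szlenk_deriv_mono[of _ _ V \<epsilon>] by simp
qed simp

text \<open>
  In contrast to the Szlenk derivation, this one commutes with finite unions; that is what makes
  the pigeonhole argument in \<open>potential_step\<close> work.
\<close>

definition sep_limits ::
    "('k::real_or_complex, 'a) nspace \<Rightarrow> real \<Rightarrow> ('a \<Rightarrow> 'k) set \<Rightarrow> ('a \<Rightarrow> 'k) set" where
  "sep_limits V \<eta> S =
     {f \<in> dual V. \<forall>U. openin (weak_star V) U \<and> f \<in> U \<longrightarrow> (\<exists>g\<in>U \<inter> S. \<eta> \<le> dual_dist V g f)}"

lemma sep_limits_mono: "S \<subseteq> S' \<Longrightarrow> \<eta>' \<le> \<eta> \<Longrightarrow> sep_limits V \<eta> S \<subseteq> sep_limits V \<eta>' S'"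
  unfolding sep_limits_def by (clarsimp, meson IntD1 IntD2 IntI order_trans subsetD)

text \<open>Fixes the directions of rounding in \<open>potential_step\<close>: thresholds may go
  down, and the radius of the underlying ball up, without losing members.\<close>

lemma foldr_sep_limits_mono:
  assumes "list_all2 (\<le>) \<eta>s' \<eta>s" "S \<subseteq> S'"
  shows "foldr (sep_limits V) \<eta>s S \<subseteq> foldr (sep_limits V) \<eta>s' S'"
  using assms(1)
proof (induction rule: list_all2_induct)
  case (Cons \<eta>' \<eta>s' \<eta> \<eta>s)
  then show ?case using sep_limits_mono[of _ _ \<eta>' \<eta> V] by simp
qed (use assms in simp)

section \<open>Comparison of separated limits with Szlenk derivations\<close>

context normed_space
begin

text \<open>Each member is its own witness at distance 0. Zero thresholds serve as padding in
  \<open>potential_values_nonempty\<close>.\<close>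

lemma subset_sep_limits_zero: "S \<subseteq> dual V \<Longrightarrow> S \<subseteq> sep_limits V 0 S"
  unfolding sep_limits_def by (auto intro!: bexI simp: dual_dist_self)

text \<open>Of two points more than \<epsilon> apart, one is at distance at least \<epsilon> / 2
  from \<open>f\<close>, by the triangle inequality. This halving is the origin of the factor 2 in
  \<open>summable_c0_sum\<close>.\<close>

lemma szlenk_deriv_subset_sep_limits:
  assumes S: "S \<subseteq> dual V"
  shows "szlenk_deriv V \<epsilon> S \<subseteq> sep_limits V (\<epsilon> / 2) S"
proof (cases "0 < \<epsilon>")
  case False
  then have "szlenk_deriv V \<epsilon> S = S" by (simp add: szlenk_deriv_def)
  then show ?thesis
    using subset_sep_limits_zero[OF S] sep_limits_mono[of S S "\<epsilon> / 2" 0 V] False by auto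
next
  case True
  show ?thesis
  proof
    fix f assume f: "f \<in> szlenk_deriv V \<epsilon> S"
    note iff = mem_szlenk_deriv_iff[OF S True, of f]
    from f iff S have fV: "f \<in> dual V" by auto
    have "\<exists>g\<in>U \<inter> S. \<epsilon> / 2 \<le> dual_dist V g f" if "openin (weak_star V) U" "f \<in> U" for U
    proof -
      obtain g h where gh: "g \<in> U \<inter> S" "h \<in> U \<inter> S" "\<epsilon> < dual_dist V g h"
        using f iff \<open>openin (weak_star V) U\<close> \<open>f \<in> U\<close> by blast
      then have "g \<in> dual V" "h \<in> dual V" using S by auto
      then have "\<epsilon> < dual_dist V g f + dual_dist V h f"
        using gh(3) dual_dist_triangle[of g f h] dual_dist_commute[of f h] fV by simp
      then have "\<epsilon> / 2 \<le> dual_dist V g f \<or> \<epsilon> / 2 \<le> dual_dist V h f" by linarith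
      then show ?thesis using gh by blast
    qed
    then show "f \<in> sep_limits V (\<epsilon> / 2) S"
      using fV by (simp add: sep_limits_def)
  qed
qed

text \<open>A derivation removes from \<open>S\<close> the union of all open sets that meet it in
  diameter at most \<epsilon>.\<close>

lemma closedin_szlenk_deriv:
  assumes "closedin (weak_star V) S"
  shows "closedin (weak_star V) (szlenk_deriv V \<epsilon> S)"
proof (cases "0 < \<epsilon>")
  case True
  have "szlenk_deriv V \<epsilon> S = S - \<Union> {U. openin (weak_star V) U \<and> \<not> ereal \<epsilon> < norm_diam V (U \<inter> S)}"
    using True by (auto simp: szlenk_deriv_def)
  then show ?thesis
    using assms by (metis (no_types, lifting) closedin_diff mem_Collect_eq openin_Union)
qed (use assms in \<open>simp add: szlenk_deriv_def\<close>)

text \<open>The factor \<theta> < 1 turns the non-strict inequality in \<open>sep_limits\<close>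
  into the strict one in \<open>szlenk_deriv\<close>; closedness of \<open>S\<close> brings the
  limit \<open>f\<close> back into \<open>S\<close>.\<close>

lemma sep_limits_subset_szlenk_deriv:
  assumes S: "closedin (weak_star V) S" and \<eta>: "0 \<le> \<eta>" and \<theta>: "0 \<le> \<theta>" "\<theta> < 1"
  shows "sep_limits V \<eta> S \<subseteq> szlenk_deriv V (\<theta> * \<eta>) S"
proof
  fix f assume f: "f \<in> sep_limits V \<eta> S"
  have sub: "S \<subseteq> dual V" using closedin_subset[OF S] by simp
  have fS: "f \<in> S"
  proof (rule ccontr)
    \<comment> \<open>Otherwise the complement of \<open>S\<close> in the dual is a neighbourhood of
      \<open>f\<close> that contains no witness.\<close>
    assume "f \<notin> S"
    then show False
      using f S by (auto simp: sep_limits_def closedin_def dest!: spec[of _ "dual V - S"])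
  qed
  show "f \<in> szlenk_deriv V (\<theta> * \<eta>) S"
  proof (cases "0 < \<theta> * \<eta>")
    case True
    then have lt: "\<theta> * \<eta> < \<eta>"
      using \<theta> \<eta> by (metis less_eq_real_def mult.commute mult.right_neutral mult_strict_left_mono mult_zero_right)
    have "\<exists>g\<in>U \<inter> S. \<exists>h\<in>U \<inter> S. \<theta> * \<eta> < dual_dist V g h"
      if U: "openin (weak_star V) U" "f \<in> U" for U
    proof -
      obtain g where "g \<in> U \<inter> S" "\<eta> \<le> dual_dist V g f"
        using f U by (auto simp: sep_limits_def)
      \<comment> \<open>The limit \<open>f\<close> is itself the second point of the pair.\<close>
      then show ?thesis using fS U lt by force
    qed
    then show ?thesis using mem_szlenk_deriv_iff[OF sub True] fS by blast
  qed (use fS in \<open>simp add: szlenk_deriv_def\<close>)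
qed

text \<open>Closedness passes from each derived set to the next, so the one-step comparison can be
  iterated. It is used at both ends: \<theta> tending to 1 transfers the summability bound, and
  \<theta> = 0, where the derivations do nothing, shows that closed sets absorb separated
  limits.\<close>

lemma foldr_sep_limits_subset_szlenk_deriv:
  assumes S: "closedin (weak_star V) S" and \<eta>s: "\<forall>\<eta>\<in>set \<eta>s. 0 \<le> \<eta>" and \<theta>: "0 \<le> \<theta>" "\<theta> < 1"
  shows "foldr (sep_limits V) \<eta>s S \<subseteq> foldr (szlenk_deriv V) (map ((*) \<theta>) \<eta>s) S"
  using \<eta>s
proof (induction \<eta>s)
  case (Cons \<eta> \<eta>s)
  let ?D = "foldr (szlenk_deriv V) (map ((*) \<theta>) \<eta>s) S"
  have "closedin (weak_star V) ?D"
    by (induction \<eta>s) (use S closedin_szlenk_deriv in auto)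
  then have "sep_limits V \<eta> ?D \<subseteq> szlenk_deriv V (\<theta> * \<eta>) ?D"
    using Cons.prems \<theta> by (intro sep_limits_subset_szlenk_deriv) auto
  moreover have "sep_limits V \<eta> (foldr (sep_limits V) \<eta>s S) \<subseteq> sep_limits V \<eta> ?D"
    using Cons by (intro sep_limits_mono) auto
  ultimately show ?case by simp
qed simp

end

section \<open>Adjoints of bounded operators\<close>

text \<open>The radius is a parameter because the potential weighs it against the thresholds; radius
  1 gives the set in \<open>M_summable_szlenk_def\<close>, by
  \<open>adjoint_ball_one\<close>.\<close>

definition adjoint_ball ::
    "('k::real_or_complex, 'a) nspace \<Rightarrow> ('k, 'b) nspace \<Rightarrow> ('a \<Rightarrow> 'b) \<Rightarrow> real \<Rightarrow> ('a \<Rightarrow> 'k) set" where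
  "adjoint_ball V W T r = adjoint_op V T ` {g \<in> dual W. dual_norm W g \<le> r}"

locale bounded_operator = V: normed_space V + W: normed_space W
  for V :: "('k::real_or_complex, 'a) nspace" and W :: "('k, 'b) nspace" +
  fixes T :: "'a \<Rightarrow> 'b" and R :: real
  assumes linear: "T \<in> linear_ops V W"
    and R_nonneg: "0 \<le> R"
    and bounded: "x \<in> carrier V \<Longrightarrow> nrm W (T x) \<le> R * nrm V x"
begin

lemma adjoint_op_dual:
  assumes g: "g \<in> dual W"
  shows "adjoint_op V T g \<in> dual V" "dual_norm V (adjoint_op V T g) \<le> R * dual_norm W g"
proof -
  note T = linear_opsD[OF linear]
  have "norm (g (T x)) \<le> R * dual_norm W g * nrm V x" if x: "x \<in> carrier V" for x
  proof -
    have "norm (g (T x)) \<le> dual_norm W g * nrm W (T x)"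
      by (rule W.norm_le_dual_norm[OF g T(1)[OF x]])
    also have "\<dots> \<le> dual_norm W g * (R * nrm V x)"
      by (rule mult_left_mono[OF bounded[OF x] W.dual_norm_nonneg[OF g]])
    finally show ?thesis by (simp add: algebra_simps)
  qed
  note * = V.dualI[of "adjoint_op V T g" "R * dual_norm W g"]
  show "adjoint_op V T g \<in> dual V" "dual_norm V (adjoint_op V T g) \<le> R * dual_norm W g"
    by (rule *; use \<open>\<And>x. x \<in> carrier V \<Longrightarrow> norm (g (T x)) \<le> _\<close> R_nonneg W.dual_norm_nonneg[OF g] T
        dualD(3,4)[OF g] in \<open>simp add: adjoint_op_def\<close>)+
qed

lemma continuous_map_adjoint_op: "continuous_map (weak_star W) (weak_star V) (adjoint_op V T)"
proof (rule V.continuous_map_into_weak_star)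
  show "adjoint_op V T \<in> topspace (weak_star W) \<rightarrow> dual V"
    using adjoint_op_dual(1) by simp
  show "continuous_map (weak_star W) euclidean (\<lambda>g. adjoint_op V T g x)" if "x \<in> carrier V" for x
    using W.continuous_map_weak_star_eval[OF linear_opsD(1)[OF linear that]] that
    by (simp add: adjoint_op_def)
qed

lemma adjoint_ball_subset_dual: "adjoint_ball V W T r \<subseteq> dual V"
  unfolding adjoint_ball_def using adjoint_op_dual(1) by auto

text \<open>A weak*-continuous image of a weak*-compact ball is compact, hence closed in the
  Hausdorff weak* topology.\<close>

lemma closedin_adjoint_ball: "0 \<le> r \<Longrightarrow> closedin (weak_star V) (adjoint_ball V W T r)"
  unfolding adjoint_ball_def
  by (intro compactin_imp_closedin V.Hausdorff_space_weak_star
      image_compactin[OF W.compactin_weak_star_ball continuous_map_adjoint_op])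

lemma adjoint_ball_one: "adjoint_op V T ` dual_ball W = adjoint_ball V W T 1"
proof -
  have "dual_ball W = {g \<in> dual W. dual_norm W g \<le> 1}"
    unfolding dual_ball_def using W.op_norm_dual by (auto simp: one_ereal_def)
  then show ?thesis by (simp add: adjoint_ball_def)
qed

lemma adjoint_ball_mono: "r \<le> r' \<Longrightarrow> adjoint_ball V W T r \<subseteq> adjoint_ball V W T r'"
  unfolding adjoint_ball_def by (intro image_mono) auto

lemma dual_norm_adjoint_ball: 
  assumes f: "f \<in> adjoint_ball V W T r"
  shows "dual_norm V f \<le> R * r"
proof -
  obtain g where "f = adjoint_op V T g" "g \<in> dual W" "dual_norm W g \<le> r"
    using f by (auto simp: adjoint_ball_def)
  then show ?thesis
    using adjoint_op_dual(2)[of g] mult_left_mono[of "dual_norm W g" r R] R_nonneg by simp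
qed

end

lemma (in normed_space) dual_scale:
  assumes f: "f \<in> dual V" and r: "0 \<le> r"
  shows "(\<lambda>x\<in>carrier V. of_real r * f x) \<in> dual V"
    "dual_norm V (\<lambda>x\<in>carrier V. of_real r * f x) \<le> r * dual_norm V f"
proof -
  have "norm (of_real r * f x) \<le> r * dual_norm V f * nrm V x" if "x \<in> carrier V" for x
    using mult_left_mono[OF norm_le_dual_norm[OF f that] r] r by (simp add: norm_mult)
  note * = dualI[of "\<lambda>x\<in>carrier V. of_real r * f x" "r * dual_norm V f"]
  show "(\<lambda>x\<in>carrier V. of_real r * f x) \<in> dual V"
    "dual_norm V (\<lambda>x\<in>carrier V. of_real r * f x) \<le> r * dual_norm V f"
    by (rule *; use \<open>\<And>x. x \<in> carrier V \<Longrightarrow> norm _ \<le> _\<close> r dual_norm_nonneg[OF f]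
        dualD(3,4)[OF f] in \<open>simp add: algebra_simps\<close>)+
qed

section \<open>Summability for adjoint images of balls of arbitrary radius\<close>

locale summable_operator = bounded_operator V W T R
  for V :: "('k::real_or_complex, 'a) nspace" and W :: "('k, 'b) nspace" and T R +
  fixes M :: real
  assumes M_nonneg: "0 \<le> M"
    and summable: "M_summable_szlenk M V W T"
begin

text \<open>Multiplication by \<open>1 / c\<close> is weak*-continuous, divides distances by
  \<open>c\<close> and maps the image of the ball of radius \<open>c\<close> into that of the unit
  ball. So a nonempty derived set with parameters \<epsilon>s yields one for the unit ball with
  parameters \<epsilon>s divided by \<open>c\<close>.\<close>

lemma sum_szlenk_adjoint_ball_le:
  assumes c: "0 < c" and ne: "foldr (szlenk_deriv V) \<epsilon>s (adjoint_ball V W T c) \<noteq> {}"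
  shows "sum_list \<epsilon>s \<le> c * M"
proof -
  define \<Phi> :: "('a \<Rightarrow> 'k) \<Rightarrow> 'a \<Rightarrow> 'k" where "\<Phi> = (\<lambda>f. \<lambda>x\<in>carrier V. of_real (1 / c) * f x)"
  let ?K = "adjoint_ball V W T"
  have \<Phi>_dual: "\<Phi> f \<in> dual V" if "f \<in> dual V" for f
    using V.dual_scale(1)[OF that, of "1 / c"] c by (simp add: \<Phi>_def)
  have cont: "continuous_map (weak_star V) (weak_star V) \<Phi>"
  proof (rule V.continuous_map_into_weak_star)
    show "\<Phi> \<in> topspace (weak_star V) \<rightarrow> dual V" using \<Phi>_dual by simp
    fix x assume x: "x \<in> carrier V"
    have "continuous_map (weak_star V) euclidean ((\<lambda>z. of_real (1 / c) * z) \<circ> (\<lambda>f. f x))"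
      by (rule continuous_map_compose[OF V.continuous_map_weak_star_eval[OF x]])
        (use c in \<open>auto intro!: continuous_intros\<close>)
    then show "continuous_map (weak_star V) euclidean (\<lambda>f. \<Phi> f x)"
      using x by (simp add: \<Phi>_def o_def)
  qed
  have dist: "(1 / c) * dual_dist V f g \<le> dual_dist V (\<Phi> f) (\<Phi> g)" if "f \<in> ?K c" "g \<in> ?K c" for f g
  proof -
    have fg: "f \<in> dual V" "g \<in> dual V" using that adjoint_ball_subset_dual by auto
    have "dual_dist V f g \<le> c * dual_dist V (\<Phi> f) (\<Phi> g)"
    proof (rule V.dual_dist_le[OF fg])
      show "0 \<le> c * dual_dist V (\<Phi> f) (\<Phi> g)"
        using c V.dual_dist_nonneg[OF \<Phi>_dual \<Phi>_dual] fg by simp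
      fix x assume x: "x \<in> carrier V"
      have eq: "norm (\<Phi> f x - \<Phi> g x) = norm (f x - g x) / c"
        using x c by (simp add: \<Phi>_def norm_divide flip: diff_divide_distrib)
      then show "norm (f x - g x) \<le> c * dual_dist V (\<Phi> f) (\<Phi> g) * nrm V x"
        using mult_left_mono[OF V.norm_diff_le_dual_dist[OF \<Phi>_dual \<Phi>_dual x, OF fg], of c] c
        by (simp add: eq mult.assoc)
    qed
    then show ?thesis using c by (simp add: field_simps)
  qed
  have image: "\<Phi> ` ?K c \<subseteq> ?K 1"
  proof
    fix f' assume "f' \<in> \<Phi> ` ?K c"
    then obtain g where g: "f' = \<Phi> (adjoint_op V T g)" "g \<in> dual W" "dual_norm W g \<le> c"
      by (auto simp: adjoint_ball_def)
    let ?g = "\<lambda>y\<in>carrier W. of_real (1 / c) * g y"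
    have "?g \<in> dual W" "dual_norm W ?g \<le> 1 / c * dual_norm W g"
      using W.dual_scale[OF g(2), of "1 / c"] c by auto
    moreover have "1 / c * dual_norm W g \<le> 1" using g(3) c by simp
    moreover have "f' = adjoint_op V T ?g"
      unfolding g(1) using linear_opsD(1)[OF linear] by (auto simp: \<Phi>_def adjoint_op_def)
    ultimately show "f' \<in> ?K 1" by (auto simp: adjoint_ball_def)
  qed
  have "\<Phi> ` foldr (szlenk_deriv V) \<epsilon>s (?K c) \<subseteq> foldr (szlenk_deriv V) (map ((*) (1 / c)) \<epsilon>s) (\<Phi> ` ?K c)"
    by (rule foldr_szlenk_deriv_image[OF V.normed_space_axioms V.normed_space_axioms cont
          adjoint_ball_subset_dual _ dist]) (use c in auto)
  also have "\<dots> \<subseteq> foldr (szlenk_deriv V) (map ((*) (1 / c)) \<epsilon>s) (?K 1)"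
    by (rule foldr_szlenk_deriv_mono[OF image])
  finally have "sum_list (map ((*) (1 / c)) \<epsilon>s) \<le> M"
    using ne summable unfolding M_summable_szlenk_def set_summable_szlenk_def adjoint_ball_one by blast
  then show ?thesis using c by (simp add: sum_list_const_mult field_simps)
qed

text \<open>Szlenk derivations reach the thresholds only up to a factor \<theta> < 1; the bound
  holds for every such \<theta> and thus in the limit.\<close>

lemma sum_sep_limits_adjoint_ball_le:
  assumes c: "0 < c" and \<eta>s: "\<forall>\<eta>\<in>set \<eta>s. 0 \<le> \<eta>"
    and ne: "foldr (sep_limits V) \<eta>s (adjoint_ball V W T c) \<noteq> {}"
  shows "sum_list \<eta>s \<le> c * M"
proof (rule field_le_mult_one_interval)
  fix \<theta> :: real assume "0 < \<theta>" "\<theta> < 1"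
  then have "foldr (szlenk_deriv V) (map ((*) \<theta>) \<eta>s) (adjoint_ball V W T c) \<noteq> {}"
    using V.foldr_sep_limits_subset_szlenk_deriv[OF closedin_adjoint_ball \<eta>s, of c \<theta>] c ne by auto
  from sum_szlenk_adjoint_ball_le[OF c this] show "\<theta> * sum_list \<eta>s \<le> c * M"
    by (simp add: sum_list_const_mult)
qed

text \<open>The comparison with Szlenk derivations at \<theta> = 0, which rests on closedness of the
  ball's image.\<close>

lemma foldr_sep_limits_adjoint_ball_subset:
  assumes c: "0 < c" and \<eta>s: "\<forall>\<eta>\<in>set \<eta>s. 0 \<le> \<eta>"
  shows "foldr (sep_limits V) \<eta>s (adjoint_ball V W T c) \<subseteq> adjoint_ball V W T c"
  using V.foldr_sep_limits_subset_szlenk_deriv[OF closedin_adjoint_ball \<eta>s, of c 0] c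
    foldr_szlenk_deriv_subset by fastforce

end

section \<open>The potential of a functional\<close>

text \<open>Radius 0 is excluded because the bound on the thresholds is obtained by dividing by
  \<open>c\<close>; the cap at 1 confines the radius to a bounded range that a finite grid can
  cover.\<close>

definition potential_values ::
    "('k::real_or_complex, 'a) nspace \<Rightarrow> ('k, 'b) nspace \<Rightarrow> ('a \<Rightarrow> 'b) \<Rightarrow> real \<Rightarrow> nat \<Rightarrow> ('a \<Rightarrow> 'k) \<Rightarrow> real set" where
  "potential_values V W T C k f =
     {C * c - sum_list \<eta>s | c \<eta>s. 0 < c \<and> c \<le> 1 \<and> length \<eta>s = k \<and> (\<forall>\<eta>\<in>set \<eta>s. 0 \<le> \<eta>) \<and>
        f \<in> foldr (sep_limits V) \<eta>s (adjoint_ball V W T c)}"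

text \<open>Used for \<open>f\<close> in the adjoint image of the unit ball only, where the infimum is not vacuous.\<close>

definition potential ::
    "('k::real_or_complex, 'a) nspace \<Rightarrow> ('k, 'b) nspace \<Rightarrow> ('a \<Rightarrow> 'b) \<Rightarrow> real \<Rightarrow> nat \<Rightarrow> ('a \<Rightarrow> 'k) \<Rightarrow> real" where
  "potential V W T C k f = Inf (potential_values V W T C k f)"

context summable_operator
begin

text \<open>The share M c of the cost pays for the thresholds, and the share R c still dominates the
  norm.\<close>

lemma dual_norm_le_potential_values:
  assumes "v \<in> potential_values V W T (M + R) k f"
  shows "dual_norm V f \<le> v"
proof -
  obtain c \<eta>s where v: "v = (M + R) * c - sum_list \<eta>s" and c: "0 < c" and \<eta>s: "\<forall>\<eta>\<in>set \<eta>s. 0 \<le> \<eta>"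
    and f: "f \<in> foldr (sep_limits V) \<eta>s (adjoint_ball V W T c)"
    using assms by (auto simp: potential_values_def)
  have "sum_list \<eta>s \<le> c * M"
    using sum_sep_limits_adjoint_ball_le[OF c \<eta>s] f by auto
  moreover have "dual_norm V f \<le> R * c"
    using foldr_sep_limits_adjoint_ball_subset[OF c \<eta>s] f by (intro dual_norm_adjoint_ball) auto
  ultimately show ?thesis by (simp add: v algebra_simps)
qed

lemma bdd_below_potential_values: "bdd_below (potential_values V W T (M + R) k f)"
  using dual_norm_le_potential_values by (rule bdd_belowI)

text \<open>Radius 1 and \<open>k\<close> zero thresholds are always admissible.\<close>

lemma potential_values_nonempty:
  assumes f: "f \<in> adjoint_ball V W T 1"
  shows "potential_values V W T C k f \<noteq> {}"
proof -
  have "f \<in> foldr (sep_limits V) (replicate k 0) (adjoint_ball V W T 1)"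
  proof (induction k)
    case (Suc k)
    have "foldr (sep_limits V) (replicate k 0) (adjoint_ball V W T 1) \<subseteq> dual V"
      \<comment> \<open>For \<open>k = 0\<close> the set is the adjoint ball itself; otherwise the
        outermost \<open>sep_limits\<close> lies in the dual by definition.\<close>
      by (cases k) (auto simp: sep_limits_def adjoint_ball_subset_dual[THEN subsetD])
    from V.subset_sep_limits_zero[OF this] show ?case using Suc by auto
  qed (simp add: f)
  then have "C * 1 - sum_list (replicate k 0) \<in> potential_values V W T C k f"
    unfolding potential_values_def by (intro CollectI exI[of _ 1] exI[of _ "replicate k 0"]) auto
  then show ?thesis by blast
qed

lemma dual_norm_le_potential:
  assumes "f \<in> adjoint_ball V W T 1"
  shows "dual_norm V f \<le> potential V W T (M + R) k f"
  unfolding potential_def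
  using potential_values_nonempty[OF assms] dual_norm_le_potential_values by (rule cInf_greatest)

lemma potential_le:
  assumes "0 < c" "c \<le> 1" "\<forall>\<eta>\<in>set \<eta>s. 0 \<le> \<eta>" "f \<in> foldr (sep_limits V) \<eta>s (adjoint_ball V W T c)"
  shows "potential V W T (M + R) (length \<eta>s) f \<le> (M + R) * c - sum_list \<eta>s"
  unfolding potential_def
  by (rule cInf_lower[OF _ bdd_below_potential_values]) (use assms in \<open>auto simp: potential_values_def\<close>)

lemma potential_approx:
  assumes f: "f \<in> adjoint_ball V W T 1" and \<delta>: "0 < \<delta>"
  obtains c \<eta>s where "0 < c" "c \<le> 1" "length \<eta>s = k" "\<forall>\<eta>\<in>set \<eta>s. 0 \<le> \<eta>"
    "f \<in> foldr (sep_limits V) \<eta>s (adjoint_ball V W T c)"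
    "(M + R) * c - sum_list \<eta>s < potential V W T (M + R) k f + \<delta>"
proof -
  have "Inf (potential_values V W T (M + R) k f) < potential V W T (M + R) k f + \<delta>"
    using \<delta> by (simp add: potential_def)
  then obtain v where "v \<in> potential_values V W T (M + R) k f" "v < potential V W T (M + R) k f + \<delta>"
    using cInf_lessD[OF potential_values_nonempty[OF f]] by blast
  then show ?thesis using that by (auto simp: potential_values_def)
qed

text \<open>Serves the start of the induction, where \<open>c\<close> is the norm of a coordinate
  functional and may vanish. Since radius 0 is not admissible, that case is reached through small
  positive radii.\<close>

lemma potential_zero_le:
  assumes f: "f \<in> adjoint_ball V W T c" and c: "0 \<le> c" "c \<le> 1"
  shows "potential V W T (M + R) 0 f \<le> (M + R) * c"
proof (rule field_le_epsilon)
  fix e :: real assume e: "0 < e"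
  show "potential V W T (M + R) 0 f \<le> (M + R) * c + e"
  proof (cases "c = 0")
    case False
    then show ?thesis using potential_le[of c "[]" f] f c e by simp
  next
    case True
    \<comment> \<open>A radius whose cost is at most \<open>e\<close>; the summand 1 keeps the
      denominator positive.\<close>
    define d where "d = min 1 (e / (M + R + 1))"
    have d: "0 < d" "d \<le> 1" "d \<le> e / (M + R + 1)"
      using e M_nonneg R_nonneg by (auto simp: d_def)
    have "f \<in> adjoint_ball V W T d" using f adjoint_ball_mono[of c d] True d by auto
    then have "potential V W T (M + R) 0 f \<le> (M + R) * d"
      using potential_le[of d "[]" f] d by simp
    also have "\<dots> \<le> (M + R + 1) * d" using d by (simp add: algebra_simps)
    also have "\<dots> \<le> e" using d(3) M_nonneg R_nonneg by (simp add: field_simps)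
    finally show ?thesis using True by simp
  qed
qed

end

section \<open>Rounding to a finite grid\<close>

lemma grid_floor:
  assumes N: "0 < (N::nat)" and x: "0 \<le> x" "x \<le> B"
  obtains y where "y \<in> (\<lambda>j. real j / real N) ` {..nat \<lceil>real N * B\<rceil>}" "y \<le> x" "x \<le> y + 1 / N" "0 \<le> y"
proof -
  define j where "j = nat \<lfloor>real N * x\<rfloor>"
  have "0 \<le> real N * x" "real N * x \<le> real N * B" using x by (auto intro: mult_left_mono)
  then have j: "real j \<le> real N * x" "real N * x \<le> real j + 1" "j \<le> nat \<lceil>real N * B\<rceil>"
    unfolding j_def by linarith+
  show ?thesis
    by (rule that[of "real j / real N"]) (use j N in \<open>auto simp: field_simps\<close>)
qed

text \<open>For radii, which are rounded up; as 1 is a grid point, the result stays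
  admissible.\<close>

lemma grid_ceiling:
  assumes N: "0 < (N::nat)" and x: "0 < x" "x \<le> 1"
  obtains y where "y \<in> (\<lambda>j. real j / real N) ` {..N}" "x \<le> y" "y \<le> x + 1 / N" "y \<le> 1"
proof -
  define j where "j = nat \<lceil>real N * x\<rceil>"
  have "0 < real N * x" "real N * x \<le> real N" using x N by (auto simp: mult_left_le)
  then have j: "real N * x \<le> real j" "real j \<le> real N * x + 1" "j \<le> N"
    unfolding j_def by linarith+
  show ?thesis
    by (rule that[of "real j / real N"]) (use j N in \<open>auto simp: field_simps\<close>)
qed

lemma grid_floor_list:
  assumes N: "0 < (N::nat)" and xs: "\<forall>x\<in>set xs. 0 \<le> x \<and> x \<le> B"
  obtains ys where "set ys \<subseteq> (\<lambda>j. real j / real N) ` {..nat \<lceil>real N * B\<rceil>}" "list_all2 (\<le>) ys xs"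
    "sum_list xs \<le> sum_list ys + length xs / N" "\<forall>y\<in>set ys. 0 \<le> y"
proof -
  have "\<exists>ys. set ys \<subseteq> (\<lambda>j. real j / real N) ` {..nat \<lceil>real N * B\<rceil>} \<and> list_all2 (\<le>) ys xs \<and>
    sum_list xs \<le> sum_list ys + length xs / N \<and> (\<forall>y\<in>set ys. 0 \<le> y)"
    using xs
  proof (induction xs)
    case (Cons x xs)
    then obtain ys where ys: "set ys \<subseteq> (\<lambda>j. real j / real N) ` {..nat \<lceil>real N * B\<rceil>}"
      "list_all2 (\<le>) ys xs" "sum_list xs \<le> sum_list ys + length xs / N" "\<forall>y\<in>set ys. 0 \<le> y"
      by auto
    obtain y where y: "y \<in> (\<lambda>j. real j / real N) ` {..nat \<lceil>real N * B\<rceil>}" "y \<le> x" "x \<le> y + 1 / N" "0 \<le> y"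
      using grid_floor[OF N, of x B] Cons.prems by auto
    show ?case
      by (rule exI[of _ "y # ys"]) (use y ys in \<open>auto simp: add_divide_distrib\<close>)
  qed simp
  then show ?thesis using that by blast
qed

section \<open>The step inequality for the potential\<close>

context summable_operator
begin

text \<open>
  Rounding the parameters of all potential values to a finite grid leaves finitely many
  candidates; each candidate that does not occur at \<open>f\<close> is excluded by its own neighbourhood of \<open>f\<close>.
\<close>

lemma potential_step:
  assumes f: "f \<in> adjoint_ball V W T 1" and \<delta>: "0 < \<delta>"
  obtains U where "openin (weak_star V) U" "f \<in> U"
    "\<And>g. g \<in> U \<Longrightarrow> g \<in> adjoint_ball V W T 1 \<Longrightarrow>
       potential V W T (M + R) (Suc k) f + dual_dist V g f \<le> potential V W T (M + R) k g + \<delta>"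
proof -
  \<comment> \<open>Total error in units of \<open>1 / N\<close>: M + R from rounding the radius,
    \<open>k\<close> from the thresholds, one from the distance, and one from approximating the
    infimum.\<close>
  define L where "L = M + R + real k + 2"
  have L: "0 < L" using M_nonneg R_nonneg by (simp add: L_def)
  obtain N :: nat where N: "0 < N" "L / \<delta> < real N"
    using reals_Archimedean2[of "max 0 (L / \<delta>)"] by (auto simp: max_def split: if_splits intro: gr0I)
  then have NL: "L / N \<le> \<delta>" using \<delta> by (simp add: field_simps)
  \<comment> \<open>A common bound for the thresholds, whose sum is at most M, and for distances in
    the adjoint ball, which are at most 2 R.\<close>
  define B where "B = M + 2 * R"
  define G where "G = (\<lambda>j. real j / real N) ` ({..N} \<union> {..nat \<lceil>real N * B\<rceil>})"
  define D where "D = G \<times> G \<times> {\<eta>s. set \<eta>s \<subseteq> G \<and> length \<eta>s = k}"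
  have "finite D" by (auto simp: D_def G_def intro!: finite_lists_length_eq)
  have fV: "f \<in> dual V" using f adjoint_ball_subset_dual by auto
  let ?S = "\<lambda>c \<eta>s. foldr (sep_limits V) \<eta>s (adjoint_ball V W T c)"
  \<comment> \<open>If \<open>f\<close> is no separated limit for the parameters, \<open>U\<close>
    witnesses this: all members of the derived set in \<open>U\<close> are closer to
    \<open>f\<close> than \<open>m\<close>. Otherwise any neighbourhood will do, so a choice exists
    for every triple.\<close>
  define excl where "excl c m \<eta>s U \<longleftrightarrow> openin (weak_star V) U \<and> f \<in> U \<and>
     (f \<notin> sep_limits V m (?S c \<eta>s) \<longrightarrow> (\<forall>g\<in>U \<inter> ?S c \<eta>s. dual_dist V g f < m))" for c m \<eta>s U
  have ex: "\<exists>U. excl c m \<eta>s U" for c m \<eta>s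
  proof (cases "f \<in> sep_limits V m (?S c \<eta>s)")
    case True
    then show ?thesis using fV openin_topspace[of "weak_star V"] by (auto simp: excl_def)
  next
    case False
    then obtain U where U: "openin (weak_star V) U" "f \<in> U"
        "\<not> (\<exists>g\<in>U \<inter> ?S c \<eta>s. m \<le> dual_dist V g f)"
      using fV unfolding sep_limits_def by blast
    then have "excl c m \<eta>s U" unfolding excl_def by (meson not_le)
    then show ?thesis by blast
  qed
  define Q where "Q c m \<eta>s = (SOME U. excl c m \<eta>s U)" for c m \<eta>s
  have Q: "excl c m \<eta>s (Q c m \<eta>s)" for c m \<eta>s
    unfolding Q_def by (rule someI_ex[OF ex])
  have Q_open: "openin (weak_star V) (Q c m \<eta>s)" and Q_mem: "f \<in> Q c m \<eta>s" for c m \<eta>s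
    using Q[of c m \<eta>s] unfolding excl_def by blast+
  have Q_excl: "f \<in> sep_limits V m (?S c \<eta>s)"
    if "g \<in> Q c m \<eta>s" "g \<in> ?S c \<eta>s" "m \<le> dual_dist V g f" for c m \<eta>s g
    using Q[of c m \<eta>s] that unfolding excl_def by (meson IntI not_le)
  define U where "U = (\<Inter>p\<in>D. Q (fst p) (fst (snd p)) (snd (snd p))) \<inter> topspace (weak_star V)"
  show ?thesis
  proof (rule that)
    show "openin (weak_star V) U"
      unfolding U_def by (rule openin_INT[OF \<open>finite D\<close>]) (rule Q_open)
    show "f \<in> U" using Q_mem fV by (simp add: U_def)
    fix g assume gU: "g \<in> U" and g: "g \<in> adjoint_ball V W T 1"
    have gV: "g \<in> dual V" using g adjoint_ball_subset_dual by auto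
    obtain c \<eta>s where c: "0 < c" "c \<le> 1" and len: "length \<eta>s = k" and \<eta>s: "\<forall>\<eta>\<in>set \<eta>s. 0 \<le> \<eta>"
      and gS: "g \<in> ?S c \<eta>s"
      and approx: "(M + R) * c - sum_list \<eta>s < potential V W T (M + R) k g + 1 / N"
      using potential_approx[OF g, of "1 / N" k] N by auto
    have "sum_list \<eta>s \<le> M"
      using sum_sep_limits_adjoint_ball_le[OF c(1) \<eta>s] gS c M_nonneg mult_right_mono[of c 1 M] by force
    then have \<eta>s_le: "\<forall>\<eta>\<in>set \<eta>s. 0 \<le> \<eta> \<and> \<eta> \<le> B"
      using \<eta>s member_le_sum_list[of _ \<eta>s] R_nonneg by (force simp: B_def)
    obtain \<eta>s' where \<eta>s': "set \<eta>s' \<subseteq> G" "list_all2 (\<le>) \<eta>s' \<eta>s"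
        "sum_list \<eta>s \<le> sum_list \<eta>s' + k / N" "\<forall>y\<in>set \<eta>s'. 0 \<le> y"
      using grid_floor_list[OF N(1) \<eta>s_le] len unfolding G_def by (metis image_Un sup.coboundedI2)
    obtain c' where c': "c' \<in> G" "c \<le> c'" "c' \<le> c + 1 / N" "c' \<le> 1"
      using grid_ceiling[OF N(1) c] unfolding G_def by (metis UnI1 image_Un)
    have "dual_norm V f \<le> R" "dual_norm V g \<le> R"
      using dual_norm_adjoint_ball[of _ 1] f g by auto
    then have "dual_dist V g f \<le> B"
      using V.dual_diff(2)[OF gV fV] M_nonneg by (simp add: B_def)
    then obtain m where m: "m \<in> G" "m \<le> dual_dist V g f" "dual_dist V g f \<le> m + 1 / N" "0 \<le> m"
      using grid_floor[OF N(1) V.dual_dist_nonneg[OF gV fV]] unfolding G_def by (metis UnI2 image_Un)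
    have len': "length \<eta>s' = k" using list_all2_lengthD[OF \<eta>s'(2)] len by simp
    \<comment> \<open>Membership of \<open>g\<close> survives, since the radius went up and the
      thresholds went down.\<close>
    have "g \<in> ?S c' \<eta>s'"
      using foldr_sep_limits_mono[OF \<eta>s'(2) adjoint_ball_mono[OF c'(2)]] gS by auto
    moreover have "(c', m, \<eta>s') \<in> D"
      using c' m \<eta>s' len' by (simp add: D_def)
    with gU have "g \<in> Q (fst (c', m, \<eta>s')) (fst (snd (c', m, \<eta>s'))) (snd (snd (c', m, \<eta>s')))"
      unfolding U_def by blast
    \<comment> \<open>Here \<open>g\<close> lies in the neighbourhood of its own rounded triple at
      distance at least \<open>m\<close>, so this triple cannot be one that \<open>f\<close>
      excludes.\<close>
    ultimately have "f \<in> sep_limits V m (?S c' \<eta>s')"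
      using m(2) by (intro Q_excl) simp_all
    \<comment> \<open>The distance from \<open>g\<close> to \<open>f\<close>, rounded down, becomes
      the outermost threshold at \<open>f\<close>; this is the gain in the step inequality.\<close>
    then have "f \<in> ?S c' (m # \<eta>s')" by simp
    then have "potential V W T (M + R) (Suc k) f \<le> (M + R) * c' - (m + sum_list \<eta>s')"
      using potential_le[of c' "m # \<eta>s'" f] c c' m(4) \<eta>s'(4) len' by simp
    moreover have "(M + R) * c' \<le> (M + R) * c + (M + R) / N"
      using mult_left_mono[OF c'(3), of "M + R"] M_nonneg R_nonneg by (simp add: algebra_simps)
    ultimately have "potential V W T (M + R) (Suc k) f + dual_dist V g f \<le>
        potential V W T (M + R) k g + L / N"
      using m(3) \<eta>s'(3) approx by (simp add: L_def add_divide_distrib)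
    then show "potential V W T (M + R) (Suc k) f + dual_dist V g f \<le> potential V W T (M + R) k g + \<delta>"
      using NL by simp
  qed
qed

end

section \<open>Direct sums\<close>

text \<open>A nearly norming vector is multiplied by a scalar of modulus 1 that makes the value real
  and nonnegative, so that values on different coordinates add up without cancellation.\<close>

lemma (in normed_space) dual_norm_approx:
  assumes f: "f \<in> dual V" and e: "e < dual_norm V f"
  obtains x t where "x \<in> carrier V" "nrm V x \<le> 1" "f x = of_real t" "e < t"
proof -
  have "ereal e < op_norm V scalars f" using e op_norm_dual[OF f] by simp
  then obtain x where x: "x \<in> carrier V" "nrm V x \<le> 1" "e < norm (f x)"
    unfolding op_norm_def by (auto simp: less_SUP_iff)
  show ?thesis
  proof (cases "f x = 0")
    case True
    then show ?thesis using that[of x 0] x by simp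
  next
    case False
    let ?c = "of_real (norm (f x)) / f x"
    have "norm ?c = 1" using False by (simp add: norm_divide)
    moreover have "f (?c \<odot>\<^bsub>V\<^esub> x) = of_real (norm (f x))"
      using dualD(4)[OF f x(1), of ?c] False by simp
    ultimately show ?thesis using that[of "?c \<odot>\<^bsub>V\<^esub> x" "norm (f x)"] x nrm_smult[OF x(1), of ?c] by simp
  qed
qed

definition c0_inj ::
    "'i set \<Rightarrow> ('i \<Rightarrow> ('k::real_or_complex, 'a) nspace) \<Rightarrow> 'i \<Rightarrow> 'a \<Rightarrow> 'i \<Rightarrow> 'a" where
  "c0_inj \<Lambda> X i x = (\<lambda>j\<in>\<Lambda>. if j = i then x else \<zero>\<^bsub>X j\<^esub>)"

definition c0_restrict ::
    "'i set \<Rightarrow> ('i \<Rightarrow> ('k::real_or_complex, 'a) nspace) \<Rightarrow> 'i set \<Rightarrow> ('i \<Rightarrow> 'a) \<Rightarrow> 'i \<Rightarrow> 'a" where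
  "c0_restrict \<Lambda> X F x = (\<lambda>j\<in>\<Lambda>. if j \<in> F then x j else \<zero>\<^bsub>X j\<^esub>)"

text \<open>The restriction of a functional to the i-th summand. As the adjoint of a bounded
  injection it is weak*-continuous by \<open>continuous_map_adjoint_op\<close>.\<close>

abbreviation c0_coord ::
    "'i set \<Rightarrow> ('i \<Rightarrow> ('k::real_or_complex, 'a) nspace) \<Rightarrow> 'i \<Rightarrow> (('i \<Rightarrow> 'a) \<Rightarrow> 'k) \<Rightarrow> 'a \<Rightarrow> 'k" where
  "c0_coord \<Lambda> X i \<equiv> adjoint_op (X i) (c0_inj \<Lambda> X i)"

lemma c0_sum_simps [simp]:
  "\<zero>\<^bsub>c0_sum \<Lambda> X\<^esub> = (\<lambda>i\<in>\<Lambda>. \<zero>\<^bsub>X i\<^esub>)"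
  "x \<oplus>\<^bsub>c0_sum \<Lambda> X\<^esub> y = (\<lambda>i\<in>\<Lambda>. x i \<oplus>\<^bsub>X i\<^esub> y i)"
  "c \<odot>\<^bsub>c0_sum \<Lambda> X\<^esub> x = (\<lambda>i\<in>\<Lambda>. c \<odot>\<^bsub>X i\<^esub> x i)"
  "nrm (c0_sum \<Lambda> X) x = (SUP i\<in>\<Lambda>. nrm (X i) (x i))"
  by (simp_all add: c0_sum_def)

lemma mem_carrier_c0_sum:
  "x \<in> carrier (c0_sum \<Lambda> X) \<longleftrightarrow> x \<in> extensional \<Lambda> \<and> (\<forall>i\<in>\<Lambda>. x i \<in> carrier (X i)) \<and>
     (\<forall>\<epsilon>>0. finite {i\<in>\<Lambda>. nrm (X i) (x i) \<ge> \<epsilon>})"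
  by (auto simp: c0_sum_def PiE_def)

locale c0_family =
  fixes \<Lambda> :: "'i set" and X :: "'i \<Rightarrow> ('k::real_or_complex, 'a) nspace"
  assumes nonempty: "\<Lambda> \<noteq> {}"
    and normed: "i \<in> \<Lambda> \<Longrightarrow> normed_space (X i)"
begin

text \<open>The common membership test for sums, multiples, restrictions, injections and operator
  images: comparison with a scalar family that vanishes at infinity.\<close>

lemma c0_sum_dominated:
  assumes "x \<in> extensional \<Lambda>" and "\<And>i. i \<in> \<Lambda> \<Longrightarrow> x i \<in> carrier (X i)"
    and fin: "\<And>\<epsilon>. 0 < \<epsilon> \<Longrightarrow> finite {i\<in>\<Lambda>. g i \<ge> \<epsilon>}"
    and le: "\<And>i. i \<in> \<Lambda> \<Longrightarrow> nrm (X i) (x i) \<le> r * g i" and r: "0 \<le> r"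
  shows "x \<in> carrier (c0_sum \<Lambda> X)"
proof -
  have "finite {i\<in>\<Lambda>. nrm (X i) (x i) \<ge> \<epsilon>}" if "0 < \<epsilon>" for \<epsilon>
  proof (cases "r = 0")
    case True
    then have "{i\<in>\<Lambda>. nrm (X i) (x i) \<ge> \<epsilon>} = {}" using le that by force
    then show ?thesis by (simp only: finite.emptyI)
  next
    case False
    then have "{i\<in>\<Lambda>. nrm (X i) (x i) \<ge> \<epsilon>} \<subseteq> {i\<in>\<Lambda>. g i \<ge> \<epsilon> / r}"
      using le r by (fastforce simp: field_simps intro: order_trans)
    moreover have "finite {i\<in>\<Lambda>. g i \<ge> \<epsilon> / r}" using fin[of "\<epsilon> / r"] that r False by simp
    ultimately show ?thesis by (rule finite_subset)
  qed
  then show ?thesis using assms(1,2) by (simp add: mem_carrier_c0_sum)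
qed

text \<open>All but finitely many coordinates have norm below 1, so the real supremum defining the
  norm is a genuine one.\<close>

lemma bdd_above_nrm:
  assumes x: "x \<in> carrier (c0_sum \<Lambda> X)"
  shows "bdd_above ((\<lambda>i. nrm (X i) (x i)) ` \<Lambda>)"
proof -
  let ?F = "{i\<in>\<Lambda>. nrm (X i) (x i) \<ge> 1}"
  have "finite ?F" using x by (simp add: mem_carrier_c0_sum)
  then have "bdd_above ((\<lambda>i. nrm (X i) (x i)) ` ?F \<union> {..1})" by simp
  then show ?thesis by (rule bdd_above_mono) auto
qed

lemma nrm_coord_le:
  "x \<in> carrier (c0_sum \<Lambda> X) \<Longrightarrow> i \<in> \<Lambda> \<Longrightarrow> nrm (X i) (x i) \<le> nrm (c0_sum \<Lambda> X) x"
  using bdd_above_nrm by (auto intro: cSUP_upper)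

lemma nrm_c0_sum_le:
  "(\<And>i. i \<in> \<Lambda> \<Longrightarrow> nrm (X i) (x i) \<le> r) \<Longrightarrow> nrm (c0_sum \<Lambda> X) x \<le> r"
  using nonempty by (auto intro: cSUP_least)

lemma c0_sum_coord: "x \<in> carrier (c0_sum \<Lambda> X) \<Longrightarrow> i \<in> \<Lambda> \<Longrightarrow> x i \<in> carrier (X i)"
  by (simp add: mem_carrier_c0_sum)

lemma add_closed_c0_sum:
  assumes x: "x \<in> carrier (c0_sum \<Lambda> X)" and y: "y \<in> carrier (c0_sum \<Lambda> X)"
  shows "x \<oplus>\<^bsub>c0_sum \<Lambda> X\<^esub> y \<in> carrier (c0_sum \<Lambda> X)"
proof (rule c0_sum_dominated)
  let ?g = "\<lambda>i. nrm (X i) (x i) + nrm (X i) (y i)"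
  show "finite {i\<in>\<Lambda>. ?g i \<ge> \<epsilon>}" if "0 < \<epsilon>" for \<epsilon>
  proof (rule finite_subset)
    show "{i\<in>\<Lambda>. ?g i \<ge> \<epsilon>} \<subseteq> {i\<in>\<Lambda>. nrm (X i) (x i) \<ge> \<epsilon> / 2} \<union> {i\<in>\<Lambda>. nrm (X i) (y i) \<ge> \<epsilon> / 2}"
      by auto
    show "finite ({i\<in>\<Lambda>. nrm (X i) (x i) \<ge> \<epsilon> / 2} \<union> {i\<in>\<Lambda>. nrm (X i) (y i) \<ge> \<epsilon> / 2})"
      using x y half_gt_zero[OF that] unfolding mem_carrier_c0_sum finite_Un by blast
  qed
  fix i assume i: "i \<in> \<Lambda>"
  interpret normed_space "X i" by (rule normed[OF i])
  show "(x \<oplus>\<^bsub>c0_sum \<Lambda> X\<^esub> y) i \<in> carrier (X i)"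
    using i c0_sum_coord x y by simp
  show "nrm (X i) ((x \<oplus>\<^bsub>c0_sum \<Lambda> X\<^esub> y) i) \<le> 1 * ?g i"
    using i c0_sum_coord x y nrm_triangle by simp
qed auto

lemma smult_closed_c0_sum:
  assumes x: "x \<in> carrier (c0_sum \<Lambda> X)"
  shows "c \<odot>\<^bsub>c0_sum \<Lambda> X\<^esub> x \<in> carrier (c0_sum \<Lambda> X)"
proof (rule c0_sum_dominated)
  show "finite {i\<in>\<Lambda>. nrm (X i) (x i) \<ge> \<epsilon>}" if "0 < \<epsilon>" for \<epsilon>
    using x that by (simp add: mem_carrier_c0_sum)
  fix i assume i: "i \<in> \<Lambda>"
  interpret normed_space "X i" by (rule normed[OF i])
  show "(c \<odot>\<^bsub>c0_sum \<Lambda> X\<^esub> x) i \<in> carrier (X i)"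
    using i c0_sum_coord x by simp
  show "nrm (X i) ((c \<odot>\<^bsub>c0_sum \<Lambda> X\<^esub> x) i) \<le> norm c * nrm (X i) (x i)"
    using i c0_sum_coord x nrm_smult by simp
qed auto

lemma c0_restrict_closed:
  assumes x: "x \<in> carrier (c0_sum \<Lambda> X)"
  shows "c0_restrict \<Lambda> X F x \<in> carrier (c0_sum \<Lambda> X)"
proof (rule c0_sum_dominated)
  show "finite {i\<in>\<Lambda>. nrm (X i) (x i) \<ge> \<epsilon>}" if "0 < \<epsilon>" for \<epsilon>
    using x that by (simp add: mem_carrier_c0_sum)
  fix i assume i: "i \<in> \<Lambda>"
  interpret normed_space "X i" by (rule normed[OF i])
  show "c0_restrict \<Lambda> X F x i \<in> carrier (X i)"
    using i c0_sum_coord x by (simp add: c0_restrict_def)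
  show "nrm (X i) (c0_restrict \<Lambda> X F x i) \<le> 1 * nrm (X i) (x i)"
    using i c0_sum_coord x nrm_nonneg by (simp add: c0_restrict_def)
qed (simp_all add: c0_restrict_def)

lemma c0_inj_closed:
  assumes i: "i \<in> \<Lambda>" and x: "x \<in> carrier (X i)"
  shows "c0_inj \<Lambda> X i x \<in> carrier (c0_sum \<Lambda> X)"
proof (rule c0_sum_dominated)
  show "finite {j\<in>\<Lambda>. (if j = i then nrm (X i) x else 0) \<ge> \<epsilon>}" if "0 < \<epsilon>" for \<epsilon>
    by (rule finite_subset[of _ "{i}"]) (use that in auto)
  fix j assume j: "j \<in> \<Lambda>"
  interpret normed_space "X j" by (rule normed[OF j])
  show "c0_inj \<Lambda> X i x j \<in> carrier (X j)"
    using j x by (simp add: c0_inj_def)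
  show "nrm (X j) (c0_inj \<Lambda> X i x j) \<le> 1 * (if j = i then nrm (X i) x else 0)"
    using j x by (simp add: c0_inj_def)
qed (simp_all add: c0_inj_def)

sublocale S: normed_space "c0_sum \<Lambda> X"
proof (rule normed_space.intro)
  \<comment> \<open>Taken from any member of the nonempty family.\<close>
  have cring: "cring (scalars :: ('k, 'k) nspace)"
    using nonempty normed normed_space.axioms(1) module.axioms(1) by blast
  have zero: "\<zero>\<^bsub>c0_sum \<Lambda> X\<^esub> \<in> carrier (c0_sum \<Lambda> X)"
  proof (rule c0_sum_dominated[where g = "\<lambda>_. 0" and r = 0])
    fix i assume i: "i \<in> \<Lambda>"
    interpret normed_space "X i" by (rule normed[OF i])
    show "\<zero>\<^bsub>c0_sum \<Lambda> X\<^esub> i \<in> carrier (X i)" "nrm (X i) (\<zero>\<^bsub>c0_sum \<Lambda> X\<^esub> i) \<le> 0 * 0"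
      using i by simp_all
  qed auto
  have mod: "module scalars (X i)" if "i \<in> \<Lambda>" for i
    using normed[OF that] by (rule normed_space.axioms(1))
  have ab: "abelian_group (X i)" if "i \<in> \<Lambda>" for i
    using mod[OF that] by (rule module.axioms(2))
  have "abelian_group (c0_sum \<Lambda> X)"
  proof (rule abelian_groupI)
    fix x y z
    assume x: "x \<in> carrier (c0_sum \<Lambda> X)" and y: "y \<in> carrier (c0_sum \<Lambda> X)" and z: "z \<in> carrier (c0_sum \<Lambda> X)"
    show "x \<oplus>\<^bsub>c0_sum \<Lambda> X\<^esub> y \<oplus>\<^bsub>c0_sum \<Lambda> X\<^esub> z = x \<oplus>\<^bsub>c0_sum \<Lambda> X\<^esub> (y \<oplus>\<^bsub>c0_sum \<Lambda> X\<^esub> z)"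
      using x y z c0_sum_coord abelian_monoid.a_assoc[OF abelian_group.axioms(1)[OF ab]]
      by (auto intro!: restrict_ext)
  next
    fix x y
    assume x: "x \<in> carrier (c0_sum \<Lambda> X)" and y: "y \<in> carrier (c0_sum \<Lambda> X)"
    show "x \<oplus>\<^bsub>c0_sum \<Lambda> X\<^esub> y = y \<oplus>\<^bsub>c0_sum \<Lambda> X\<^esub> x"
      using x y c0_sum_coord abelian_monoid.a_comm[OF abelian_group.axioms(1)[OF ab]]
      by (auto intro!: restrict_ext)
  next
    fix x assume x: "x \<in> carrier (c0_sum \<Lambda> X)"
    then have ext: "x \<in> extensional \<Lambda>" by (simp add: mem_carrier_c0_sum)
    show "\<zero>\<^bsub>c0_sum \<Lambda> X\<^esub> \<oplus>\<^bsub>c0_sum \<Lambda> X\<^esub> x = x"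
      using x c0_sum_coord abelian_monoid.l_zero[OF abelian_group.axioms(1)[OF ab]]
      by (intro extensionalityI[OF _ ext]) auto
    show "\<exists>y\<in>carrier (c0_sum \<Lambda> X). y \<oplus>\<^bsub>c0_sum \<Lambda> X\<^esub> x = \<zero>\<^bsub>c0_sum \<Lambda> X\<^esub>"
    proof
      show "(- 1) \<odot>\<^bsub>c0_sum \<Lambda> X\<^esub> x \<in> carrier (c0_sum \<Lambda> X)"
        by (rule smult_closed_c0_sum[OF x])
      have "(- 1) \<odot>\<^bsub>X i\<^esub> x i \<oplus>\<^bsub>X i\<^esub> x i = \<zero>\<^bsub>X i\<^esub>" if i: "i \<in> \<Lambda>" for i
      proof -
        interpret normed_space "X i" by (rule normed[OF i])
        have "(- 1 + 1) \<odot>\<^bsub>X i\<^esub> x i = (- 1) \<odot>\<^bsub>X i\<^esub> x i \<oplus>\<^bsub>X i\<^esub> x i"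
          using smult_l_distr[of "- 1" 1 "x i"] smult_one[of "x i"] c0_sum_coord[OF x i] by simp
        then show ?thesis using zero_smult[OF c0_sum_coord[OF x i]] by simp
      qed
      then show "(- 1) \<odot>\<^bsub>c0_sum \<Lambda> X\<^esub> x \<oplus>\<^bsub>c0_sum \<Lambda> X\<^esub> x = \<zero>\<^bsub>c0_sum \<Lambda> X\<^esub>"
        by (auto intro!: restrict_ext)
    qed
  qed (use add_closed_c0_sum zero in auto)
  then show "module scalars (c0_sum \<Lambda> X)"
  proof (rule moduleI[OF cring])
    fix a b :: 'k and x y
    assume x: "x \<in> carrier (c0_sum \<Lambda> X)"
    show "a \<odot>\<^bsub>c0_sum \<Lambda> X\<^esub> x \<in> carrier (c0_sum \<Lambda> X)"
      by (rule smult_closed_c0_sum[OF x])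
    show "(a \<oplus>\<^bsub>scalars\<^esub> b) \<odot>\<^bsub>c0_sum \<Lambda> X\<^esub> x =
        a \<odot>\<^bsub>c0_sum \<Lambda> X\<^esub> x \<oplus>\<^bsub>c0_sum \<Lambda> X\<^esub> b \<odot>\<^bsub>c0_sum \<Lambda> X\<^esub> x"
      using module.smult_l_distr[OF mod, of _ a b] c0_sum_coord[OF x] by (auto intro!: restrict_ext)
    show "(a \<otimes>\<^bsub>scalars\<^esub> b) \<odot>\<^bsub>c0_sum \<Lambda> X\<^esub> x = a \<odot>\<^bsub>c0_sum \<Lambda> X\<^esub> (b \<odot>\<^bsub>c0_sum \<Lambda> X\<^esub> x)"
      using module.smult_assoc1[OF mod, of _ a b] c0_sum_coord[OF x] by (auto intro!: restrict_ext)
    have ext: "x \<in> extensional \<Lambda>" using x by (simp add: mem_carrier_c0_sum)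
    show "\<one>\<^bsub>scalars\<^esub> \<odot>\<^bsub>c0_sum \<Lambda> X\<^esub> x = x"
      using module.smult_one[OF mod] c0_sum_coord[OF x] by (intro extensionalityI[OF _ ext]) auto
    assume y: "y \<in> carrier (c0_sum \<Lambda> X)"
    show "a \<odot>\<^bsub>c0_sum \<Lambda> X\<^esub> (x \<oplus>\<^bsub>c0_sum \<Lambda> X\<^esub> y) =
        a \<odot>\<^bsub>c0_sum \<Lambda> X\<^esub> x \<oplus>\<^bsub>c0_sum \<Lambda> X\<^esub> a \<odot>\<^bsub>c0_sum \<Lambda> X\<^esub> y"
      using module.smult_r_distr[OF mod, of _ a] c0_sum_coord[OF x] c0_sum_coord[OF y]
      by (auto intro!: restrict_ext)
  qed
  show "normed_space_axioms (c0_sum \<Lambda> X)"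
  proof
    fix x assume x: "x \<in> carrier (c0_sum \<Lambda> X)"
    then have ext: "x \<in> extensional \<Lambda>" by (simp add: mem_carrier_c0_sum)
    note nn = normed_space.nrm_nonneg[OF normed c0_sum_coord[OF x]]
    note zero_iff = normed_space.nrm_eq_zero_iff[OF normed c0_sum_coord[OF x]]
    show "nrm (c0_sum \<Lambda> X) x = 0 \<longleftrightarrow> x = \<zero>\<^bsub>c0_sum \<Lambda> X\<^esub>"
    proof
      assume "nrm (c0_sum \<Lambda> X) x = 0"
      then have "nrm (X i) (x i) = 0" if "i \<in> \<Lambda>" for i
        using nrm_coord_le[OF x that] nn[OF that that] by linarith
      then show "x = \<zero>\<^bsub>c0_sum \<Lambda> X\<^esub>"
        using zero_iff by (intro extensionalityI[OF ext]) auto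
    next
      assume "x = \<zero>\<^bsub>c0_sum \<Lambda> X\<^esub>"
      then have "nrm (X i) (x i) = 0" if "i \<in> \<Lambda>" for i using zero_iff that by simp
      then show "nrm (c0_sum \<Lambda> X) x = 0" using nonempty by simp
    qed
    fix c
    have eq: "nrm (X i) ((c \<odot>\<^bsub>c0_sum \<Lambda> X\<^esub> x) i) = norm c * nrm (X i) (x i)" if "i \<in> \<Lambda>" for i
      using normed_space.nrm_smult[OF normed[OF that] c0_sum_coord[OF x that], of c] that by simp
    show "nrm (c0_sum \<Lambda> X) (c \<odot>\<^bsub>c0_sum \<Lambda> X\<^esub> x) = norm c * nrm (c0_sum \<Lambda> X) x"
    proof (rule antisym)
      show "nrm (c0_sum \<Lambda> X) (c \<odot>\<^bsub>c0_sum \<Lambda> X\<^esub> x) \<le> norm c * nrm (c0_sum \<Lambda> X) x"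
        by (rule nrm_c0_sum_le) (use eq nrm_coord_le[OF x] in \<open>simp add: mult_left_mono del: c0_sum_simps\<close>)
      show "norm c * nrm (c0_sum \<Lambda> X) x \<le> nrm (c0_sum \<Lambda> X) (c \<odot>\<^bsub>c0_sum \<Lambda> X\<^esub> x)"
      proof (cases "c = 0")
        case True
        obtain i where i: "i \<in> \<Lambda>" using nonempty by auto
        then show ?thesis
          using True eq[OF i] nrm_coord_le[OF smult_closed_c0_sum[OF x, of c] i] by (simp del: c0_sum_simps)
      next
        case False
        have "nrm (c0_sum \<Lambda> X) x \<le> nrm (c0_sum \<Lambda> X) (c \<odot>\<^bsub>c0_sum \<Lambda> X\<^esub> x) / norm c"
        proof (rule nrm_c0_sum_le)
          fix i assume i: "i \<in> \<Lambda>"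
          show "nrm (X i) (x i) \<le> nrm (c0_sum \<Lambda> X) (c \<odot>\<^bsub>c0_sum \<Lambda> X\<^esub> x) / norm c"
            using nrm_coord_le[OF smult_closed_c0_sum[OF x, of c] i] False
            unfolding eq[OF i] by (simp add: field_simps del: c0_sum_simps)
        qed
        then show ?thesis using False by (simp add: field_simps del: c0_sum_simps)
      qed
    qed
    fix y assume y: "y \<in> carrier (c0_sum \<Lambda> X)"
    show "nrm (c0_sum \<Lambda> X) (x \<oplus>\<^bsub>c0_sum \<Lambda> X\<^esub> y) \<le> nrm (c0_sum \<Lambda> X) x + nrm (c0_sum \<Lambda> X) y"
    proof (rule nrm_c0_sum_le)
      fix i assume i: "i \<in> \<Lambda>"
      have "nrm (X i) ((x \<oplus>\<^bsub>c0_sum \<Lambda> X\<^esub> y) i) \<le> nrm (X i) (x i) + nrm (X i) (y i)"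
        using normed_space.nrm_triangle[OF normed[OF i]] c0_sum_coord[OF x i] c0_sum_coord[OF y i] i by simp
      then show "nrm (X i) ((x \<oplus>\<^bsub>c0_sum \<Lambda> X\<^esub> y) i) \<le> nrm (c0_sum \<Lambda> X) x + nrm (c0_sum \<Lambda> X) y"
        using nrm_coord_le[OF x i] nrm_coord_le[OF y i] by linarith
    qed
  qed
qed

section \<open>Coordinate maps, and the dual norm as an l1 sum\<close>

lemma bounded_operator_c0_inj:
  assumes i: "i \<in> \<Lambda>"
  shows "bounded_operator (X i) (c0_sum \<Lambda> X) (c0_inj \<Lambda> X i) 1"
proof -
  interpret Xi: normed_space "X i" by (rule normed[OF i])
  show ?thesis
  proof
    have zero: "\<zero>\<^bsub>X j\<^esub> \<oplus>\<^bsub>X j\<^esub> \<zero>\<^bsub>X j\<^esub> = \<zero>\<^bsub>X j\<^esub>" "c \<odot>\<^bsub>X j\<^esub> \<zero>\<^bsub>X j\<^esub> = \<zero>\<^bsub>X j\<^esub>" if "j \<in> \<Lambda>" for j c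
    proof -
      interpret normed_space "X j" by (rule normed[OF that])
      show "\<zero>\<^bsub>X j\<^esub> \<oplus>\<^bsub>X j\<^esub> \<zero>\<^bsub>X j\<^esub> = \<zero>\<^bsub>X j\<^esub>" by simp
      show "c \<odot>\<^bsub>X j\<^esub> \<zero>\<^bsub>X j\<^esub> = \<zero>\<^bsub>X j\<^esub>" using smult_r_null[of c] by simp
    qed
    show "c0_inj \<Lambda> X i \<in> linear_ops (X i) (c0_sum \<Lambda> X)"
      unfolding linear_ops_def using c0_inj_closed[OF i] zero
      by (auto simp: c0_inj_def intro!: restrict_ext)
    fix x assume x: "x \<in> carrier (X i)"
    show "nrm (c0_sum \<Lambda> X) (c0_inj \<Lambda> X i x) \<le> 1 * nrm (X i) x"
      unfolding mult_1
    proof (rule nrm_c0_sum_le)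
      fix j assume j: "j \<in> \<Lambda>"
      interpret normed_space "X j" by (rule normed[OF j])
      show "nrm (X j) (c0_inj \<Lambda> X i x j) \<le> nrm (X i) x"
        using j x Xi.nrm_nonneg by (simp add: c0_inj_def)
    qed
  qed simp
qed

lemma bounded_operator_c0_proj:
  assumes i: "i \<in> \<Lambda>"
  shows "bounded_operator (c0_sum \<Lambda> X) (X i) (\<lambda>x. x i) 1"
proof -
  interpret normed_space "X i" by (rule normed[OF i])
  show ?thesis
  proof
    show "(\<lambda>x. x i) \<in> linear_ops (c0_sum \<Lambda> X) (X i)"
      unfolding linear_ops_def using c0_sum_coord i by auto
    show "nrm (X i) (x i) \<le> 1 * nrm (c0_sum \<Lambda> X) x" if "x \<in> carrier (c0_sum \<Lambda> X)" for x
      using nrm_coord_le[OF that i] by simp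
  qed simp
qed

lemma c0_coord_dual: "i \<in> \<Lambda> \<Longrightarrow> h \<in> dual (c0_sum \<Lambda> X) \<Longrightarrow> c0_coord \<Lambda> X i h \<in> dual (X i)"
  by (rule bounded_operator.adjoint_op_dual(1)[OF bounded_operator_c0_inj])

text \<open>A vector supported on finitely many coordinates is the sum of their injections; the
  coordinates are adjoined one at a time.\<close>

lemma dual_c0_restrict:
  assumes h: "h \<in> dual (c0_sum \<Lambda> X)" and x: "x \<in> carrier (c0_sum \<Lambda> X)" 
    and F: "finite F" "F \<subseteq> \<Lambda>"
  shows "h (c0_restrict \<Lambda> X F x) = (\<Sum>i\<in>F. c0_coord \<Lambda> X i h (x i))"
  using F
proof (induction F)
  case empty
  have "c0_restrict \<Lambda> X {} x = 0 \<odot>\<^bsub>c0_sum \<Lambda> X\<^esub> x"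
    using S.zero_smult[OF x] by (simp add: c0_restrict_def)
  then show ?case using dualD(4)[OF h x, of 0] by (simp del: c0_sum_simps)
next
  case (insert i F)
  then have i: "i \<in> \<Lambda>" by simp
  have "c0_restrict \<Lambda> X (insert i F) x = c0_inj \<Lambda> X i (x i) \<oplus>\<^bsub>c0_sum \<Lambda> X\<^esub> c0_restrict \<Lambda> X F x"
  proof -
    have "(if j \<in> insert i F then x j else \<zero>\<^bsub>X j\<^esub>) =
        (if j = i then x i else \<zero>\<^bsub>X j\<^esub>) \<oplus>\<^bsub>X j\<^esub> (if j \<in> F then x j else \<zero>\<^bsub>X j\<^esub>)" if "j \<in> \<Lambda>" for j
    proof -
      interpret normed_space "X j" by (rule normed[OF that])
      have "x j \<oplus>\<^bsub>X j\<^esub> \<zero>\<^bsub>X j\<^esub> = x j" "\<zero>\<^bsub>X j\<^esub> \<oplus>\<^bsub>X j\<^esub> x j = x j"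
        using c0_sum_coord[OF x that] by simp_all
      then show ?thesis using insert.hyps by auto
    qed
    then show ?thesis by (auto simp: c0_restrict_def c0_inj_def intro!: restrict_ext)
  qed
  then have "h (c0_restrict \<Lambda> X (insert i F) x) = h (c0_inj \<Lambda> X i (x i)) + h (c0_restrict \<Lambda> X F x)"
    using dualD(3)[OF h c0_inj_closed[OF i c0_sum_coord[OF x i]] c0_restrict_closed[OF x]] by simp
  then show ?case
    using insert c0_sum_coord[OF x i] by (simp add: adjoint_op_def)
qed

text \<open>Half of the duality between c0 and l1. Only finitely many coordinates of
  \<open>x\<close> have norm at least \<open>d\<close>; on these the hypothesis applies, and the
  rest of \<open>x\<close> has norm at most \<open>d\<close>, so \<open>h\<close> is small
  there.\<close>

lemma dual_norm_c0_sum_le: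
  assumes h: "h \<in> dual (c0_sum \<Lambda> X)"
    and le: "\<And>F. finite F \<Longrightarrow> F \<subseteq> \<Lambda> \<Longrightarrow> (\<Sum>i\<in>F. dual_norm (X i) (c0_coord \<Lambda> X i h)) \<le> r"
  shows "dual_norm (c0_sum \<Lambda> X) h \<le> r"
proof (rule S.dualI(2))
  show r: "0 \<le> r" using le[of "{}"] by simp
  fix x assume x: "x \<in> carrier (c0_sum \<Lambda> X)"
  show "norm (h x) \<le> r * nrm (c0_sum \<Lambda> X) x"
  proof (rule field_le_epsilon)
    fix e :: real assume e: "0 < e"
    define d where "d = e / (dual_norm (c0_sum \<Lambda> X) h + 1)"
    have hn: "0 \<le> dual_norm (c0_sum \<Lambda> X) h" by (rule S.dual_norm_nonneg[OF h])
    have d: "0 < d" "dual_norm (c0_sum \<Lambda> X) h * d \<le> e"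
      using e hn by (auto simp: d_def field_simps)
    define F where "F = {i\<in>\<Lambda>. nrm (X i) (x i) \<ge> d}"
    have F: "finite F" "F \<subseteq> \<Lambda>" using x d by (auto simp: F_def mem_carrier_c0_sum)
    let ?y = "c0_restrict \<Lambda> X F x" and ?z = "c0_restrict \<Lambda> X (- F) x"
    note yz = c0_restrict_closed[OF x, of F] c0_restrict_closed[OF x, of "- F"]
    have ext: "x \<in> extensional \<Lambda>" using x by (simp add: mem_carrier_c0_sum)
    have "x = ?y \<oplus>\<^bsub>c0_sum \<Lambda> X\<^esub> ?z"
    proof (rule extensionalityI[OF ext])
      fix j assume j: "j \<in> \<Lambda>"
      interpret normed_space "X j" by (rule normed[OF j])
      show "x j = (?y \<oplus>\<^bsub>c0_sum \<Lambda> X\<^esub> ?z) j"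
        using j c0_sum_coord[OF x j] by (simp add: c0_restrict_def)
    qed simp
    then have "h x = h ?y + h ?z" using dualD(3)[OF h yz] by simp
    then have "norm (h x) \<le> norm (h ?y) + norm (h ?z)" by (simp add: norm_triangle_ineq)
    moreover have "norm (h ?y) \<le> r * nrm (c0_sum \<Lambda> X) x"
    proof -
      have nx: "0 \<le> nrm (c0_sum \<Lambda> X) x" by (rule S.nrm_nonneg[OF x])
      have "norm (h ?y) \<le> (\<Sum>i\<in>F. norm (c0_coord \<Lambda> X i h (x i)))"
        unfolding dual_c0_restrict[OF h x F] by (rule norm_sum)
      also have "\<dots> \<le> (\<Sum>i\<in>F. dual_norm (X i) (c0_coord \<Lambda> X i h) * nrm (c0_sum \<Lambda> X) x)"
      proof (rule sum_mono)
        fix i assume "i \<in> F"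
        then have i: "i \<in> \<Lambda>" using F by auto
        interpret normed_space "X i" by (rule normed[OF i])
        have "norm (c0_coord \<Lambda> X i h (x i)) \<le> dual_norm (X i) (c0_coord \<Lambda> X i h) * nrm (X i) (x i)"
          by (rule norm_le_dual_norm[OF c0_coord_dual[OF i h] c0_sum_coord[OF x i]])
        also have "\<dots> \<le> dual_norm (X i) (c0_coord \<Lambda> X i h) * nrm (c0_sum \<Lambda> X) x"
          by (rule mult_left_mono[OF nrm_coord_le[OF x i] dual_norm_nonneg[OF c0_coord_dual[OF i h]]])
        finally show "norm (c0_coord \<Lambda> X i h (x i)) \<le> dual_norm (X i) (c0_coord \<Lambda> X i h) * nrm (c0_sum \<Lambda> X) x" .
      qed
      also have "\<dots> \<le> r * nrm (c0_sum \<Lambda> X) x"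
        unfolding sum_distrib_right[symmetric] by (rule mult_right_mono[OF le[OF F] nx])
      finally show ?thesis .
    qed
    moreover have "norm (h ?z) \<le> e"
    proof -
      have "nrm (c0_sum \<Lambda> X) ?z \<le> d"
      proof (rule nrm_c0_sum_le)
        fix j assume j: "j \<in> \<Lambda>"
        interpret normed_space "X j" by (rule normed[OF j])
        show "nrm (X j) (?z j) \<le> d" using j d by (auto simp: c0_restrict_def F_def)
      qed
      then have "dual_norm (c0_sum \<Lambda> X) h * nrm (c0_sum \<Lambda> X) ?z \<le> dual_norm (c0_sum \<Lambda> X) h * d"
        by (rule mult_left_mono[OF _ hn])
      then show ?thesis using S.norm_le_dual_norm[OF h yz(2)] d(2) by linarith
    qed
    ultimately show "norm (h x) \<le> r * nrm (c0_sum \<Lambda> X) x + e" by linarith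
  qed
qed (use dualD[OF h] in auto)

text \<open>The other half. Nearly norming vectors for the coordinates in \<open>F\<close>, with
  real values, are assembled into one vector; its supremum norm is still at most 1 while the values
  add up.\<close>

lemma sum_dual_norm_coord_le:
  assumes h: "h \<in> dual (c0_sum \<Lambda> X)" and F: "finite F" "F \<subseteq> \<Lambda>"
  shows "(\<Sum>i\<in>F. dual_norm (X i) (c0_coord \<Lambda> X i h)) \<le> dual_norm (c0_sum \<Lambda> X) h"
proof (rule field_le_epsilon)
  fix e :: real assume e: "0 < e"
  define d where "d = e / (card F + 1)"
  have d: "0 < d" "card F * d \<le> e" using e by (auto simp: d_def field_simps)
  have "\<exists>x t. x \<in> carrier (X i) \<and> nrm (X i) x \<le> 1 \<and> c0_coord \<Lambda> X i h x = of_real t \<and>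
      dual_norm (X i) (c0_coord \<Lambda> X i h) - d < t" if "i \<in> \<Lambda>" for i
    using normed_space.dual_norm_approx[OF normed[OF that] c0_coord_dual[OF that h],
        of "dual_norm (X i) (c0_coord \<Lambda> X i h) - d"] d by (metis diff_less_eq less_add_same_cancel1)
  then obtain x t where xt: "\<And>i. i \<in> \<Lambda> \<Longrightarrow> x i \<in> carrier (X i)" "\<And>i. i \<in> \<Lambda> \<Longrightarrow> nrm (X i) (x i) \<le> 1"
      "\<And>i. i \<in> \<Lambda> \<Longrightarrow> c0_coord \<Lambda> X i h (x i) = of_real (t i)"
      "\<And>i. i \<in> \<Lambda> \<Longrightarrow> dual_norm (X i) (c0_coord \<Lambda> X i h) - d < t i"
    by metis
  define y where "y = (\<lambda>i\<in>\<Lambda>. if i \<in> F then x i else \<zero>\<^bsub>X i\<^esub>)"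
  have y: "y i \<in> carrier (X i)" "nrm (X i) (y i) \<le> (if i \<in> F then 1 else 0)" if "i \<in> \<Lambda>" for i
  proof -
    interpret normed_space "X i" by (rule normed[OF that])
    show "y i \<in> carrier (X i)" "nrm (X i) (y i) \<le> (if i \<in> F then 1 else 0)"
      using that xt by (auto simp: y_def)
  qed
  have yc: "y \<in> carrier (c0_sum \<Lambda> X)"
  proof (rule c0_sum_dominated[where r = 1])
    show "finite {i \<in> \<Lambda>. \<epsilon> \<le> (if i \<in> F then 1 else 0)}" if "0 < \<epsilon>" for \<epsilon> :: real
      by (rule finite_subset[OF _ F(1)]) (use that in auto)
  qed (use y in \<open>auto simp: y_def\<close>)
  have yF: "c0_restrict \<Lambda> X F y = y"
    by (auto simp: c0_restrict_def y_def fun_eq_iff)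
  have "h y = (\<Sum>i\<in>F. c0_coord \<Lambda> X i h (y i))"
    using dual_c0_restrict[OF h yc F] yF by simp
  also have "\<dots> = of_real (\<Sum>i\<in>F. t i)"
    unfolding of_real_sum by (rule sum.cong) (use F xt in \<open>auto simp: y_def\<close>)
  finally have "(\<Sum>i\<in>F. t i) \<le> norm (h y)" by (metis abs_ge_self norm_of_real)
  also have "\<dots> \<le> dual_norm (c0_sum \<Lambda> X) h * nrm (c0_sum \<Lambda> X) y"
    by (rule S.norm_le_dual_norm[OF h yc])
  also have "\<dots> \<le> dual_norm (c0_sum \<Lambda> X) h"
  proof -
    have "nrm (X i) (y i) \<le> 1" if "i \<in> \<Lambda>" for i using y(2)[OF that] by (auto split: if_splits)
    then have "nrm (c0_sum \<Lambda> X) y \<le> 1" by (rule nrm_c0_sum_le)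
    then show ?thesis using mult_left_mono[OF _ S.dual_norm_nonneg[OF h]] by fastforce
  qed
  finally have "(\<Sum>i\<in>F. t i) \<le> dual_norm (c0_sum \<Lambda> X) h" .
  moreover have "(\<Sum>i\<in>F. dual_norm (X i) (c0_coord \<Lambda> X i h)) \<le> (\<Sum>i\<in>F. t i + d)"
    by (rule sum_mono) (use xt(4) F in \<open>force simp: less_diff_eq\<close>)
  ultimately show "(\<Sum>i\<in>F. dual_norm (X i) (c0_coord \<Lambda> X i h)) \<le> dual_norm (c0_sum \<Lambda> X) h + e"
    using d(2) by (simp add: sum.distrib)
qed

text \<open>The contrapositive of \<open>dual_norm_c0_sum_le\<close> for \<open>g - f\<close>, whose
  coordinates are the differences of the coordinates.\<close>

lemma dual_dist_c0_sum_less: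
  assumes f: "f \<in> dual (c0_sum \<Lambda> X)" and g: "g \<in> dual (c0_sum \<Lambda> X)" and e: "e < dual_dist (c0_sum \<Lambda> X) g f"
  obtains F where "finite F" "F \<subseteq> \<Lambda>"
    "e < (\<Sum>i\<in>F. dual_dist (X i) (c0_coord \<Lambda> X i g) (c0_coord \<Lambda> X i f))"
proof -
  let ?h = "\<lambda>x\<in>carrier (c0_sum \<Lambda> X). g x - f x"
  have h: "?h \<in> dual (c0_sum \<Lambda> X)" by (rule S.dual_diff(1)[OF g f])
  obtain F where F: "finite F" "F \<subseteq> \<Lambda>" "e < (\<Sum>i\<in>F. dual_norm (X i) (c0_coord \<Lambda> X i ?h))"
    using dual_norm_c0_sum_le[OF h, of e] e unfolding dual_dist_def by force
  have "c0_coord \<Lambda> X i ?h = (\<lambda>x\<in>carrier (X i). c0_coord \<Lambda> X i g x - c0_coord \<Lambda> X i f x)" if "i \<in> F" for i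
    using c0_inj_closed[of i] that F(2) by (auto simp: adjoint_op_def intro!: restrict_ext)
  then have "(\<Sum>i\<in>F. dual_norm (X i) (c0_coord \<Lambda> X i ?h)) =
      (\<Sum>i\<in>F. dual_dist (X i) (c0_coord \<Lambda> X i g) (c0_coord \<Lambda> X i f))"
    unfolding dual_dist_def by (intro sum.cong) auto
  then show ?thesis using that F by simp
qed

end

section \<open>Operators between direct sums\<close>

locale c0_operator = X: c0_family \<Lambda> X + Y: c0_family \<Lambda> Y
  for \<Lambda> :: "'i set" and X :: "'i \<Rightarrow> ('k::real_or_complex, 'a) nspace" and Y :: "'i \<Rightarrow> ('k, 'b) nspace" +
  fixes A :: "'i \<Rightarrow> 'a \<Rightarrow> 'b" and R :: real
  assumes operators: "i \<in> \<Lambda> \<Longrightarrow> bounded_operator (X i) (Y i) (A i) R"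
begin

sublocale A: bounded_operator "c0_sum \<Lambda> X" "c0_sum \<Lambda> Y" "induced_op \<Lambda> A" R
proof
  obtain i where "i \<in> \<Lambda>" using X.nonempty by auto
  then show R: "0 \<le> R" by (rule bounded_operator.R_nonneg[OF operators])
  have lin: "A i \<in> linear_ops (X i) (Y i)" if "i \<in> \<Lambda>" for i
    by (rule bounded_operator.linear[OF operators[OF that]])
  note lin = linear_opsD[OF lin]
  have closed: "induced_op \<Lambda> A x \<in> carrier (c0_sum \<Lambda> Y)" if x: "x \<in> carrier (c0_sum \<Lambda> X)" for x
  proof (rule Y.c0_sum_dominated[OF _ _ _ _ R])
    show "finite {i \<in> \<Lambda>. \<epsilon> \<le> nrm (X i) (x i)}" if "0 < \<epsilon>" for \<epsilon>
      using x that by (simp add: mem_carrier_c0_sum)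
  qed (use X.c0_sum_coord[OF x] lin(1) bounded_operator.bounded[OF operators] in \<open>auto simp: induced_op_def\<close>)
  then show "induced_op \<Lambda> A \<in> linear_ops (c0_sum \<Lambda> X) (c0_sum \<Lambda> Y)"
    unfolding linear_ops_def using X.c0_sum_coord lin
    by (auto simp: induced_op_def intro!: restrict_ext)
  fix x assume x: "x \<in> carrier (c0_sum \<Lambda> X)"
  show "nrm (c0_sum \<Lambda> Y) (induced_op \<Lambda> A x) \<le> R * nrm (c0_sum \<Lambda> X) x"
  proof (rule Y.nrm_c0_sum_le)
    fix i assume i: "i \<in> \<Lambda>"
    have "nrm (Y i) (A i (x i)) \<le> R * nrm (X i) (x i)"
      by (rule bounded_operator.bounded[OF operators[OF i] X.c0_sum_coord[OF x i]])
    also have "\<dots> \<le> R * nrm (c0_sum \<Lambda> X) x"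
      by (rule mult_left_mono[OF X.nrm_coord_le[OF x i] R])
    finally show "nrm (Y i) (induced_op \<Lambda> A x i) \<le> R * nrm (c0_sum \<Lambda> X) x"
      using i by (simp add: induced_op_def)
  qed
qed

text \<open>The dual form of the fact that the induced operator sends the injection of
  \<open>x\<close> to the injection of \<open>A i x\<close>; away from \<open>i\<close> this uses
  that each \<open>A j\<close> maps zero to zero.\<close>

lemma coord_adjoint_op:
  assumes i: "i \<in> \<Lambda>"
  shows "c0_coord \<Lambda> X i (adjoint_op (c0_sum \<Lambda> X) (induced_op \<Lambda> A) y) =
    adjoint_op (X i) (A i) (c0_coord \<Lambda> Y i y)"
proof -
  have "induced_op \<Lambda> A (c0_inj \<Lambda> X i x) = c0_inj \<Lambda> Y i (A i x)" for x
  proof -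
    have "A j \<zero>\<^bsub>X j\<^esub> = \<zero>\<^bsub>Y j\<^esub>" if j: "j \<in> \<Lambda>" for j
    proof -
      interpret bounded_operator "X j" "Y j" "A j" R by (rule operators[OF j])
      have "A j \<zero>\<^bsub>X j\<^esub> \<in> carrier (Y j)" using linear_opsD(1)[OF linear] by simp
      moreover from this have "nrm (Y j) (A j \<zero>\<^bsub>X j\<^esub>) = 0"
        using bounded[of "\<zero>\<^bsub>X j\<^esub>"] W.nrm_nonneg by (intro antisym) simp_all
      ultimately show ?thesis using W.nrm_eq_zero_iff by blast
    qed
    then show ?thesis by (auto simp: induced_op_def c0_inj_def intro!: restrict_ext)
  qed
  then show ?thesis
    using X.c0_inj_closed[OF i] linear_opsD(1)[OF bounded_operator.linear[OF operators[OF i]]]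
    by (auto simp: adjoint_op_def intro!: restrict_ext)
qed

lemma M_summable_coord:
  assumes i: "i \<in> \<Lambda>" and sum: "M_summable_szlenk M (c0_sum \<Lambda> X) (c0_sum \<Lambda> Y) (induced_op \<Lambda> A)"
  shows "M_summable_szlenk M (X i) (Y i) (A i)"
proof -
  interpret Ai: bounded_operator "X i" "Y i" "A i" R by (rule operators[OF i])
  interpret PX: bounded_operator "c0_sum \<Lambda> X" "X i" "\<lambda>x. x i" 1
    by (rule X.bounded_operator_c0_proj[OF i])
  interpret PY: bounded_operator "c0_sum \<Lambda> Y" "Y i" "\<lambda>x. x i" 1
    by (rule Y.bounded_operator_c0_proj[OF i])
  let ?J = "adjoint_op (c0_sum \<Lambda> X) (\<lambda>x. x i)"
  let ?K = "adjoint_ball (X i) (Y i) (A i) 1" and ?L = "adjoint_ball (c0_sum \<Lambda> X) (c0_sum \<Lambda> Y) (induced_op \<Lambda> A) 1"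
  have dist: "1 * dual_dist (X i) f g \<le> dual_dist (c0_sum \<Lambda> X) (?J f) (?J g)"
    if "f \<in> ?K" "g \<in> ?K" for f g
    unfolding mult_1
  proof (rule Ai.V.dual_dist_le)
    show f: "f \<in> dual (X i)" and g: "g \<in> dual (X i)"
      using that Ai.adjoint_ball_subset_dual by auto
    note J = PX.adjoint_op_dual(1)[OF f] PX.adjoint_op_dual(1)[OF g]
    show nn: "0 \<le> dual_dist (c0_sum \<Lambda> X) (?J f) (?J g)"
      by (rule X.S.dual_dist_nonneg[OF J])
    fix x assume x: "x \<in> carrier (X i)"
    note c = X.c0_inj_closed[OF i x]
    \<comment> \<open>Testing the lifted functionals on injected vectors recovers \<open>f\<close>
      and \<open>g\<close>, and injection does not increase the norm; hence the lift does not shrink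
      distances.\<close>
    have "c0_inj \<Lambda> X i x i = x" using i by (simp add: c0_inj_def)
    then have "norm (f x - g x) \<le> dual_dist (c0_sum \<Lambda> X) (?J f) (?J g) * nrm (c0_sum \<Lambda> X) (c0_inj \<Lambda> X i x)"
      using X.S.norm_diff_le_dual_dist[OF J c] c by (simp add: adjoint_op_def del: c0_sum_simps)
    also have "\<dots> \<le> dual_dist (c0_sum \<Lambda> X) (?J f) (?J g) * nrm (X i) x"
      using bounded_operator.bounded[OF X.bounded_operator_c0_inj[OF i] x] nn
      by (intro mult_left_mono) simp_all
    finally show "norm (f x - g x) \<le> dual_dist (c0_sum \<Lambda> X) (?J f) (?J g) * nrm (X i) x" .
  qed
  have image: "?J ` ?K \<subseteq> ?L"
  proof
    fix f assume "f \<in> ?J ` ?K"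
    then obtain g where g: "f = ?J (adjoint_op (X i) (A i) g)" "g \<in> dual (Y i)" "dual_norm (Y i) g \<le> 1"
      by (auto simp: adjoint_ball_def)
    \<comment> \<open>Projecting to coordinate \<open>i\<close> and then applying \<open>A i\<close>
      equals applying the induced operator and then projecting; this is the adjoint form.\<close>
    have "f = adjoint_op (c0_sum \<Lambda> X) (induced_op \<Lambda> A) (adjoint_op (c0_sum \<Lambda> Y) (\<lambda>x. x i) g)"
      unfolding g(1) using i X.c0_sum_coord linear_opsD(1)[OF A.linear]
      by (auto simp: adjoint_op_def induced_op_def intro!: restrict_ext)
    then show "f \<in> ?L"
      using PY.adjoint_op_dual[OF g(2)] g(3) by (auto simp: adjoint_ball_def)
  qed
  have "sum_list \<epsilon>s \<le> M" if ne: "foldr (szlenk_deriv (X i)) \<epsilon>s ?K \<noteq> {}" for \<epsilon>s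
  proof -
    have "?J ` foldr (szlenk_deriv (X i)) \<epsilon>s ?K \<subseteq>
        foldr (szlenk_deriv (c0_sum \<Lambda> X)) (map ((*) 1) \<epsilon>s) (?J ` ?K)"
      by (rule foldr_szlenk_deriv_image[OF Ai.V.normed_space_axioms X.S.normed_space_axioms
            PX.continuous_map_adjoint_op Ai.adjoint_ball_subset_dual _ dist]) simp_all
    also have "\<dots> \<subseteq> foldr (szlenk_deriv (c0_sum \<Lambda> X)) (map ((*) 1) \<epsilon>s) ?L"
      by (rule foldr_szlenk_deriv_mono[OF image])
    finally have "sum_list (map ((*) 1) \<epsilon>s) \<le> M"
      using ne sum unfolding M_summable_szlenk_def set_summable_szlenk_def A.adjoint_ball_one by blast
    then show ?thesis by (simp add: sum_list_const_mult)
  qed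
  then show ?thesis
    unfolding M_summable_szlenk_def set_summable_szlenk_def Ai.adjoint_ball_one by blast
qed

section \<open>Decrease of the total potential under Szlenk derivations\<close>

text \<open>The induction must cover all \<open>f\<close> and all finite \<open>F\<close> at once:
  the step at \<open>f\<close> and \<open>F\<close> uses the hypothesis at a nearby \<open>g\<close>
  and a larger index set.\<close>

lemma potential_szlenk_deriv:
  assumes sum: "\<And>i. i \<in> \<Lambda> \<Longrightarrow> summable_operator (X i) (Y i) (A i) R M"
    and f: "f \<in> foldr (szlenk_deriv (c0_sum \<Lambda> X)) \<epsilon>s
      (adjoint_ball (c0_sum \<Lambda> X) (c0_sum \<Lambda> Y) (induced_op \<Lambda> A) 1)"
    and F: "finite F" "F \<subseteq> \<Lambda>"
  shows "(\<Sum>i\<in>F. potential (X i) (Y i) (A i) (M + R) (length \<epsilon>s) (c0_coord \<Lambda> X i f))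
    \<le> M + R - sum_list \<epsilon>s / 2"
  using f F
proof (induction \<epsilon>s arbitrary: f F)
  case Nil
  then obtain y where y: "f = adjoint_op (c0_sum \<Lambda> X) (induced_op \<Lambda> A) y"
    "y \<in> dual (c0_sum \<Lambda> Y)" "dual_norm (c0_sum \<Lambda> Y) y \<le> 1"
    by (auto simp: adjoint_ball_def)
  obtain i where "i \<in> \<Lambda>" using X.nonempty by auto
  then have C: "0 \<le> M + R"
    using summable_operator.M_nonneg[OF sum] bounded_operator.R_nonneg[OF operators] by fastforce
  have le: "dual_norm (Y i) (c0_coord \<Lambda> Y i y) \<le> 1" if "i \<in> \<Lambda>" for i
    using Y.sum_dual_norm_coord_le[OF y(2), of "{i}"] that y(3) by simp
  \<comment> \<open>Each coordinate of \<open>f\<close> comes from a ball whose radius is the norm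
    of the coordinate of \<open>y\<close>, and these radii sum to at most 1.\<close>
  have "(\<Sum>i\<in>F. potential (X i) (Y i) (A i) (M + R) 0 (c0_coord \<Lambda> X i f)) \<le>
      (\<Sum>i\<in>F. (M + R) * dual_norm (Y i) (c0_coord \<Lambda> Y i y))"
  proof (rule sum_mono)
    fix i assume "i \<in> F"
    then have i: "i \<in> \<Lambda>" using Nil by auto
    show "potential (X i) (Y i) (A i) (M + R) 0 (c0_coord \<Lambda> X i f) \<le> (M + R) * dual_norm (Y i) (c0_coord \<Lambda> Y i y)"
    proof (rule summable_operator.potential_zero_le[OF sum[OF i]])
      show "c0_coord \<Lambda> X i f \<in> adjoint_ball (X i) (Y i) (A i) (dual_norm (Y i) (c0_coord \<Lambda> Y i y))"
        using Y.c0_coord_dual[OF i y(2)] by (auto simp: y(1) coord_adjoint_op[OF i] adjoint_ball_def)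
    qed (use le i normed_space.dual_norm_nonneg[OF Y.normed[OF i] Y.c0_coord_dual[OF i y(2)]] in auto)
  qed
  also have "\<dots> \<le> (M + R) * 1"
    unfolding sum_distrib_left[symmetric]
    using Y.sum_dual_norm_coord_le[OF y(2) Nil(2,3)] y(3) by (intro mult_left_mono C) simp
  finally show ?case by simp
next
  case (Cons \<epsilon> \<epsilon>s)
  let ?K = "adjoint_ball (c0_sum \<Lambda> X) (c0_sum \<Lambda> Y) (induced_op \<Lambda> A) 1"
  let ?D = "foldr (szlenk_deriv (c0_sum \<Lambda> X)) \<epsilon>s ?K"
  let ?x = "\<lambda>i. c0_coord \<Lambda> X i"
  define p where "p k i h = potential (X i) (Y i) (A i) (M + R) k (?x i h)" for k i h
  define n where "n = length \<epsilon>s"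
  define B where "B = M + R - sum_list \<epsilon>s / 2"
  have IH: "(\<Sum>i\<in>G. p n i g) \<le> B" if "g \<in> ?D" "finite G" "G \<subseteq> \<Lambda>" for g G
    using Cons.IH[OF that] by (simp add: p_def n_def B_def)
  have DK: "?D \<subseteq> ?K" by (rule foldr_szlenk_deriv_subset)
  then have D: "?D \<subseteq> dual (c0_sum \<Lambda> X)" using A.adjoint_ball_subset_dual by blast
  have coord: "?x i g \<in> adjoint_ball (X i) (Y i) (A i) 1" if g: "g \<in> ?K" and i: "i \<in> \<Lambda>" for g i
  proof -
    obtain y where y: "g = adjoint_op (c0_sum \<Lambda> X) (induced_op \<Lambda> A) y"
      "y \<in> dual (c0_sum \<Lambda> Y)" "dual_norm (c0_sum \<Lambda> Y) y \<le> 1"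
      using g by (auto simp: adjoint_ball_def)
    have "dual_norm (Y i) (c0_coord \<Lambda> Y i y) \<le> 1"
      using Y.sum_dual_norm_coord_le[OF y(2), of "{i}"] i y(3) by simp
    then show ?thesis
      using Y.c0_coord_dual[OF i y(2)] by (auto simp: y(1) coord_adjoint_op[OF i] adjoint_ball_def)
  qed
  have norm_le: "dual_norm (X i) (?x i g) \<le> p k i g" if "g \<in> ?K" "i \<in> \<Lambda>" for g i k
    unfolding p_def by (rule summable_operator.dual_norm_le_potential[OF sum[OF that(2)] coord[OF that]])
  have p_nonneg: "0 \<le> p k i g" if "g \<in> ?K" "i \<in> \<Lambda>" for g i k
    using norm_le[OF that, of k] normed_space.dual_norm_nonneg[OF X.normed X.c0_coord_dual, OF that(2,2)]
      that(1) A.adjoint_ball_subset_dual by fastforce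
  have f': "f \<in> szlenk_deriv (c0_sum \<Lambda> X) \<epsilon> ?D" using Cons.prems by simp
  then have fD: "f \<in> ?D" and fsep: "f \<in> sep_limits (c0_sum \<Lambda> X) (\<epsilon> / 2) ?D"
    using subsetD[OF szlenk_deriv_subset] subsetD[OF X.S.szlenk_deriv_subset_sep_limits[OF D]] by blast+
  have fK: "f \<in> ?K" and fdual: "f \<in> dual (c0_sum \<Lambda> X)" using fD DK D by auto
  have "(\<Sum>i\<in>F. p (Suc n) i f) \<le> B - \<epsilon> / 2"
  proof (rule field_le_epsilon)
    fix e :: real assume e: "0 < e"
    \<comment> \<open>The error \<delta> is spent three times: locating the distance on a finite set
      \<open>G\<close>, the step inequalities on \<open>H\<close>, and the tail of \<open>f\<close>
      outside \<open>H\<close>.\<close>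
    define \<delta> where "\<delta> = e / 3"
    have \<delta>: "0 < \<delta>" using e by (simp add: \<delta>_def)
    let ?N = "\<lambda>G. \<Sum>i\<in>G. dual_norm (X i) (?x i f)"
    have "?N G \<le> B" if "finite G" "G \<subseteq> \<Lambda>" for G
      using IH[OF fD that] sum_mono[of G "\<lambda>i. dual_norm (X i) (?x i f)" "\<lambda>i. p n i f"] norm_le[OF fK] that
      by (meson order_trans subsetD)
    then have bdd: "bdd_above (?N ` {G. finite G \<and> G \<subseteq> \<Lambda>})" by (intro bdd_aboveI[of _ B]) auto
    \<comment> \<open>The coordinate norms of \<open>f\<close> have bounded finite sums, so a finite
      \<open>G1\<close> carries them up to \<delta>.\<close>
    have "Sup (?N ` {G. finite G \<and> G \<subseteq> \<Lambda>}) - \<delta> < Sup (?N ` {G. finite G \<and> G \<subseteq> \<Lambda>})" using \<delta> by simp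
    then obtain G1 where G1: "finite G1" "G1 \<subseteq> \<Lambda>" "Sup (?N ` {G. finite G \<and> G \<subseteq> \<Lambda>}) - \<delta> < ?N G1"
      by (subst (asm) less_cSup_iff) (use bdd in auto)
    have tail: "?N G \<le> \<delta>" if G: "finite G" "G \<subseteq> \<Lambda>" "G \<inter> G1 = {}" for G
    proof -
      have "?N (G \<union> G1) \<le> Sup (?N ` {G. finite G \<and> G \<subseteq> \<Lambda>})"
        using G G1 by (intro cSup_upper bdd) auto
      then show ?thesis using G1 G by (simp add: sum.union_disjoint)
    qed
    define H where "H = F \<union> G1"
    have H: "finite H" "H \<subseteq> \<Lambda>" using Cons.prems G1 by (auto simp: H_def)
    \<comment> \<open>Each of the step inequalities on \<open>H\<close> may lose this much.\<close>
    define d where "d = \<delta> / (card H + 1)"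
    have d: "0 < d" "card H * d \<le> \<delta>" using \<delta> by (auto simp: d_def field_simps)
    have "\<exists>U. openin (weak_star (X i)) U \<and> ?x i f \<in> U \<and> (\<forall>g\<in>?K. ?x i g \<in> U \<longrightarrow>
        p (Suc n) i f + dual_dist (X i) (?x i g) (?x i f) \<le> p n i g + d)" if "i \<in> \<Lambda>" for i
      unfolding p_def
      by (rule summable_operator.potential_step[OF sum[OF that] coord[OF fK that] d(1), of n])
        (use coord that in blast)
    then obtain U where U: "\<And>i. i \<in> \<Lambda> \<Longrightarrow> openin (weak_star (X i)) (U i)" "\<And>i. i \<in> \<Lambda> \<Longrightarrow> ?x i f \<in> U i"
      "\<And>i g. i \<in> \<Lambda> \<Longrightarrow> g \<in> ?K \<Longrightarrow> ?x i g \<in> U i \<Longrightarrow>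
        p (Suc n) i f + dual_dist (X i) (?x i g) (?x i f) \<le> p n i g + d"
      by metis
    \<comment> \<open>The coordinate neighbourhoods for the finitely many indices in
      \<open>H\<close>, pulled back to the dual of the sum.\<close>
    define W where "W = (\<Inter>i\<in>H. {g \<in> topspace (weak_star (c0_sum \<Lambda> X)). ?x i g \<in> U i}) \<inter>
      topspace (weak_star (c0_sum \<Lambda> X))"
    have "openin (weak_star (c0_sum \<Lambda> X)) W"
      unfolding W_def
    proof (rule openin_INT[OF H(1)])
      fix i assume "i \<in> H"
      then have i: "i \<in> \<Lambda>" using H by auto
      show "openin (weak_star (c0_sum \<Lambda> X)) {g \<in> topspace (weak_star (c0_sum \<Lambda> X)). ?x i g \<in> U i}"
        by (rule openin_continuous_map_preimage[OF
              bounded_operator.continuous_map_adjoint_op[OF X.bounded_operator_c0_inj[OF i]] U(1)[OF i]])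
    qed
    moreover have "f \<in> W" using fdual U(2) H by (auto simp: W_def)
    ultimately obtain g where g: "g \<in> W" "g \<in> ?D" "\<epsilon> / 2 \<le> dual_dist (c0_sum \<Lambda> X) g f"
      using fsep unfolding sep_limits_def by blast
    have gK: "g \<in> ?K" and gdual: "g \<in> dual (c0_sum \<Lambda> X)" using g DK D by auto
    let ?dist = "\<lambda>i. dual_dist (X i) (?x i g) (?x i f)"
    have dist_nonneg: "0 \<le> ?dist i" if "i \<in> \<Lambda>" for i
      by (rule normed_space.dual_dist_nonneg[OF X.normed X.c0_coord_dual X.c0_coord_dual]) (use that fdual gdual in auto)
    have "\<epsilon> / 2 - \<delta> < dual_dist (c0_sum \<Lambda> X) g f" using g(3) \<delta> by linarith
    from X.dual_dist_c0_sum_less[OF fdual gdual this]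
    \<comment> \<open>This set depends on \<open>g\<close>, so \<open>W\<close> gives no control on
      \<open>G - H\<close>.\<close>
    obtain G where G: "finite G" "G \<subseteq> \<Lambda>" "\<epsilon> / 2 - \<delta> < (\<Sum>i\<in>G. ?dist i)" by blast
    have inside: "(\<Sum>i\<in>H. p (Suc n) i f) + (\<Sum>i\<in>H. ?dist i) \<le> (\<Sum>i\<in>H. p n i g) + \<delta>"
    proof -
      have "(\<Sum>i\<in>H. p (Suc n) i f + ?dist i) \<le> (\<Sum>i\<in>H. p n i g + d)"
      proof (rule sum_mono)
        fix i assume i: "i \<in> H"
        then have "?x i g \<in> U i" using g(1) by (auto simp: W_def)
        then show "p (Suc n) i f + ?dist i \<le> p n i g + d" using U(3) gK i H by blast
      qed
      then show ?thesis using d(2) by (simp add: sum.distrib)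
    qed
    \<comment> \<open>Off \<open>H\<close> the distance is at most the sum of the two norms: that of
      \<open>g\<close> is absorbed by its potential, and those of \<open>f\<close> add up to at most
      \<delta>.\<close>
    have outside: "(\<Sum>i\<in>G - H. ?dist i) \<le> (\<Sum>i\<in>G - H. p n i g) + \<delta>"
    proof -
      have "(\<Sum>i\<in>G - H. ?dist i) \<le> (\<Sum>i\<in>G - H. p n i g + dual_norm (X i) (?x i f))"
      proof (rule sum_mono)
        fix i assume "i \<in> G - H"
        then have i: "i \<in> \<Lambda>" using G by auto
        show "?dist i \<le> p n i g + dual_norm (X i) (?x i f)"
          using normed_space.dual_diff(2)[OF X.normed[OF i] X.c0_coord_dual[OF i gdual] X.c0_coord_dual[OF i fdual]]
            norm_le[OF gK i, of n] by linarith
      qed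
      moreover have "?N (G - H) \<le> \<delta>" using G by (intro tail) (auto simp: H_def)
      ultimately show ?thesis by (simp add: sum.distrib)
    qed
    have "(\<Sum>i\<in>H \<union> (G - H). p n i g) \<le> B"
      using G H by (intro IH[OF g(2)]) auto
    then have "(\<Sum>i\<in>H. p n i g) + (\<Sum>i\<in>G - H. p n i g) \<le> B"
      using G H by (subst (asm) sum.union_disjoint) auto
    moreover have "(\<Sum>i\<in>G. ?dist i) \<le> (\<Sum>i\<in>H \<union> (G - H). ?dist i)"
      using G H dist_nonneg by (intro sum_mono2) auto
    then have "(\<Sum>i\<in>G. ?dist i) \<le> (\<Sum>i\<in>H. ?dist i) + (\<Sum>i\<in>G - H. ?dist i)"
      using G H by (subst (asm) sum.union_disjoint) auto
    \<comment> \<open>Passing from \<open>F\<close> to \<open>H\<close> only increases the sum, as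
      potentials are nonnegative on the adjoint ball.\<close>
    moreover have "(\<Sum>i\<in>F. p (Suc n) i f) \<le> (\<Sum>i\<in>H. p (Suc n) i f)"
      using H p_nonneg[OF fK] by (intro sum_mono2) (auto simp: H_def)
    ultimately show "(\<Sum>i\<in>F. p (Suc n) i f) \<le> B - \<epsilon> / 2 + e"
      using inside outside G(3) by (simp add: \<delta>_def)
  qed
  then show ?case by (simp add: p_def n_def B_def add_divide_distrib)
qed

text \<open>For \<open>F\<close> empty the sum of potentials is 0, which leaves 0 \<le> M + R - (sum
  of the \<epsilon>s) / 2 whenever the derived set has a member.\<close>

lemma summable_c0_sum:
  assumes sum: "\<And>i. i \<in> \<Lambda> \<Longrightarrow> summable_operator (X i) (Y i) (A i) R M"
  shows "M_summable_szlenk (2 * (M + R)) (c0_sum \<Lambda> X) (c0_sum \<Lambda> Y) (induced_op \<Lambda> A)"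
  unfolding M_summable_szlenk_def set_summable_szlenk_def A.adjoint_ball_one
  using potential_szlenk_deriv[OF sum, of _ _ "{}"] by fastforce

end

theorem theorem1p4:
  fixes \<Lambda> :: "'i set"
    and X :: "'i \<Rightarrow> ('k::real_or_complex, 'a) nspace"
    and Y :: "'i \<Rightarrow> ('k, 'b) nspace"
    and A :: "'i \<Rightarrow> 'a \<Rightarrow> 'b"
  assumes "\<Lambda> \<noteq> {}"
    and "\<And>i. i \<in> \<Lambda> \<Longrightarrow> banach_space (X i)"
    and "\<And>i. i \<in> \<Lambda> \<Longrightarrow> banach_space (Y i)"
    and "\<And>i. i \<in> \<Lambda> \<Longrightarrow> A i \<in> linear_ops (X i) (Y i)"
    and "(SUP i\<in>\<Lambda>. op_norm (X i) (Y i) (A i)) < \<infinity>"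
  shows "summable_szlenk (c0_sum \<Lambda> X) (c0_sum \<Lambda> Y) (induced_op \<Lambda> A) \<longleftrightarrow>
         (\<exists>M\<ge>0. \<forall>i\<in>\<Lambda>. M_summable_szlenk M (X i) (Y i) (A i))"
proof -
  have X: "normed_space (X i)" and Y: "normed_space (Y i)" if "i \<in> \<Lambda>" for i
    using assms(2,3)[OF that] by (auto dest: banach_space.axioms(1))
  \<comment> \<open>A natural number as bound is nonnegative by its type.\<close>
  obtain R :: nat where R: "(SUP i\<in>\<Lambda>. op_norm (X i) (Y i) (A i)) < ereal (real R)"
    using assms(5) less_PInf_Ex_of_nat by auto
  have A: "bounded_operator (X i) (Y i) (A i) (real R)" if i: "i \<in> \<Lambda>" for i
  proof (intro bounded_operator.intro bounded_operator_axioms.intro X[OF i] Y[OF i] assms(4)[OF i])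
    have "op_norm (X i) (Y i) (A i) \<le> ereal (real R)"
      using SUP_upper[OF i, of "\<lambda>i. op_norm (X i) (Y i) (A i)"] R by simp
    then show "nrm (Y i) (A i x) \<le> real R * nrm (X i) x" if "x \<in> carrier (X i)" for x
      by (rule normed_space.op_norm_bound[OF X[OF i] assms(4)[OF i] Y[OF i] _ that])
  qed simp
  interpret c0_operator \<Lambda> X Y A "real R"
    by (intro c0_operator.intro c0_operator_axioms.intro c0_family.intro X Y A assms(1))
  show ?thesis
  proof
    assume "summable_szlenk (c0_sum \<Lambda> X) (c0_sum \<Lambda> Y) (induced_op \<Lambda> A)"
    then show "\<exists>M\<ge>0. \<forall>i\<in>\<Lambda>. M_summable_szlenk M (X i) (Y i) (A i)"
      unfolding summable_szlenk_def using M_summable_coord by blast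
  next
    assume "\<exists>M\<ge>0. \<forall>i\<in>\<Lambda>. M_summable_szlenk M (X i) (Y i) (A i)"
    then obtain M where M: "0 \<le> M" "\<And>i. i \<in> \<Lambda> \<Longrightarrow> M_summable_szlenk M (X i) (Y i) (A i)" by blast
    then have "summable_operator (X i) (Y i) (A i) (real R) M" if "i \<in> \<Lambda>" for i
      using that by (intro summable_operator.intro summable_operator_axioms.intro A) auto
    from summable_c0_sum[OF this] M(1)
    show "summable_szlenk (c0_sum \<Lambda> X) (c0_sum \<Lambda> Y) (induced_op \<Lambda> A)"
      unfolding summable_szlenk_def by (intro exI[of _ "2 * (M + real R)"]) auto
  qed
qed

end
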